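(* Let $G$ be a 3-colorable, co-bridge-free, prismatic graph. Then $\Lambda(G)\le 5$, or $G$ is a Schl\"afli-prismatic graph.
   Context: A triangle is a set of three pairwise adjacent vertices. A graph $G$ is prismatic if for every triangle $T$ of $G$, every vertex not in $T$ has exactly one neighbor in $T$. The co-bridge is $C_4+2K_1$ (disjoint union of a 4-cycle and two isolated vertices); co-bridge-free means no induced co-bridge. 3-colorable means $V(G)$ can be partitioned into three stable sets. A hitting set of $G$ is a set of vertices meeting every triangle; $\Lambda(G)$ is the minimum size of a hitting set. The complement of the Schl\"afli graph has 27 vertices $r^i_j,s^i_j,t^i_j$ ($1\le i,j\le 3$); for $1\le i,i',j,j'\le3$: if $i\ne i'$ and $j\ne j'$ then $r^i_jr^{i'}_{j'}$, $s^i_js^{i'}_{j'}$, $t^i_jt^{i'}_{j'}$ are edges; if $j=i'$ then $r^i_js^{i'}_{j'}$, $s^i_jt^{i'}_{j'}$, $t^i_jr^{i'}_{j'}$ are edges; no other edges. A Schl\"afli-prismatic graph is a graph isomorphic to an induced subgraph of the complement of the Schl\"afli graph. *)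

theory Defs
  imports "Graph_Theory.Graph_Theory"
begin

text \<open>
  A finite simple graph is a \<^locale>\<open>pair_graph\<close>: a finite vertex set \<^const>\<open>pverts\<close> with a
  symmetric, irreflexive arc relation \<^const>\<open>parcs\<close>, so that \<open>(u, v) \<in> parcs G\<close> is adjacency.
  The predicates below are meant for such graphs.
\<close>

definition triangle :: "'a pair_pre_digraph \<Rightarrow> 'a set \<Rightarrow> bool" where
  "triangle G T \<longleftrightarrow>
     T \<subseteq> pverts G \<and> card T = 3 \<and> (\<forall>u\<in>T. \<forall>v\<in>T. u \<noteq> v \<longrightarrow> (u, v) \<in> parcs G)"

definition prismatic :: "'a pair_pre_digraph \<Rightarrow> bool" where
  "prismatic G \<longleftrightarrow>
     (\<forall>T. triangle G T \<longrightarrow> (\<forall>v \<in> pverts G - T. \<exists>!u. u \<in> T \<and> (v, u) \<in> parcs G))"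

definition stable_set :: "'a pair_pre_digraph \<Rightarrow> 'a set \<Rightarrow> bool" where
  "stable_set G S \<longleftrightarrow> S \<subseteq> pverts G \<and> (\<forall>u\<in>S. \<forall>v\<in>S. (u, v) \<notin> parcs G)"

text \<open>Colour classes may be empty.\<close>

definition three_colorable :: "'a pair_pre_digraph \<Rightarrow> bool" where
  "three_colorable G \<longleftrightarrow>
     (\<exists>A B C. stable_set G A \<and> stable_set G B \<and> stable_set G C \<and>
        A \<union> B \<union> C = pverts G \<and> A \<inter> B = {} \<and> A \<inter> C = {} \<and> B \<inter> C = {})"

definition isomorphic_to_induced_subgraph ::
    "'a pair_pre_digraph \<Rightarrow> 'b pair_pre_digraph \<Rightarrow> bool" where
  "isomorphic_to_induced_subgraph F G \<longleftrightarrow>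
     (\<exists>H :: 'b pair_pre_digraph. induced_subgraph H G \<and> digraph_iso F H)"

text \<open>The 4-cycle 0,1,2,3 together with the isolated vertices 4 and 5.\<close>

definition co_bridge :: "nat pair_pre_digraph" where
  "co_bridge =
     (let E = {(0, 1), (1, 2), (2, 3), (3, 0)}
      in \<lparr> pverts = {0, 1, 2, 3, 4, 5}, parcs = E \<union> E\<inverse> \<rparr>)"

definition co_bridge_free :: "'a pair_pre_digraph \<Rightarrow> bool" where
  "co_bridge_free G \<longleftrightarrow> \<not> isomorphic_to_induced_subgraph co_bridge G"

definition hitting_set :: "'a pair_pre_digraph \<Rightarrow> 'a set \<Rightarrow> bool" where
  "hitting_set G X \<longleftrightarrow> X \<subseteq> pverts G \<and> (\<forall>T. triangle G T \<longrightarrow> X \<inter> T \<noteq> {})"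

text \<open>\<open>\<Lambda>(G)\<close>; the minimum is attained since \<open>pverts G\<close> itself is a hitting set.\<close>

definition hitting_number :: "'a pair_pre_digraph \<Rightarrow> nat" where
  "hitting_number G = (LEAST k. \<exists>X. hitting_set G X \<and> card X = k)"

text \<open>
  \<open>RV i j\<close>, \<open>SV i j\<close>, \<open>TV i j\<close> stand for the vertices with superscript \<open>i\<close> and subscript \<open>j\<close>
  in the three families \<open>r\<close>, \<open>s\<close>, \<open>t\<close>; only indices in \<open>{1..3}\<close> are used.
\<close>

datatype schlafli_vertex = RV nat nat | SV nat nat | TV nat nat

definition co_schlafli :: "schlafli_vertex pair_pre_digraph" where
  "co_schlafli =
     (let I = {1..3 :: nat};
          V = {RV i j | i j. i \<in> I \<and> j \<in> I} \<union> {SV i j | i j. i \<in> I \<and> j \<in> I} \<union>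
              {TV i j | i j. i \<in> I \<and> j \<in> I};
          E = {(RV i j, RV i' j') | i j i' j'. i \<noteq> i' \<and> j \<noteq> j'} \<union>
              {(SV i j, SV i' j') | i j i' j'. i \<noteq> i' \<and> j \<noteq> j'} \<union>
              {(TV i j, TV i' j') | i j i' j'. i \<noteq> i' \<and> j \<noteq> j'} \<union>
              {(RV i j, SV i' j') | i j i' j'. j = i'} \<union>
              {(SV i j, TV i' j') | i j i' j'. j = i'} \<union>
              {(TV i j, RV i' j') | i j i' j'. j = i'}
      in \<lparr> pverts = V, parcs = (E \<union> E\<inverse>) \<inter> V \<times> V \<rparr>)"

definition schlafli_prismatic :: "'a pair_pre_digraph \<Rightarrow> bool" where
  "schlafli_prismatic G \<longleftrightarrow> isomorphic_to_induced_subgraph G co_schlafli"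

end

theory Submission
  imports Defs "HOL-Library.FuncSet"
begin

text \<open>
  Fix a 3-colouring with colours in cyclic order. For disjoint triangles \<open>t\<close>, \<open>u\<close> the matching between
  them shifts the colours cyclically, which orients the pair. A cyclically oriented triple generates
  a grid, that is, an induced \<open>L(K\<^bsub>3,3\<^esub>)\<close>.

  Without a grid the orientation is therefore transitive on pairwise disjoint triangles, and the
  minimum size of a hitting set equals the maximum number of disjoint triangles: there is always a
  triangle which is met by all others in one and the same vertex, or else a grid minus one vertex, where
  two vertices hit all triangles that meet two disjoint ones. Five disjoint triangles in transitive
  position contain a co-bridge, so \<open>\<Lambda>(G) \<le> 4\<close>.

  If there is a grid, every other vertex is joined to exactly one column (colour class) of it, and
  no triangle leaves the grid. Three vertices hit the grid. If the rest has no grid, it has no three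
  disjoint triangles, since each position of the grid relative to a transitive triple yields a
  co-bridge; so \<open>\<Lambda>(G) \<le> 5\<close>. If the rest has a second grid, any further vertex yields a co-bridge,
  so \<open>G\<close> consists of two grids and is the subgraph of the co-Schlaefli graph induced on \<open>r\<close> and \<open>s\<close>.
\<close>

section \<open>Triangles in a 3-coloured prismatic graph\<close>

datatype colour = Col0 | Col1 | Col2

fun nx :: "colour \<Rightarrow> colour" where
  "nx Col0 = Col1" | "nx Col1 = Col2" | "nx Col2 = Col0"

fun pv :: "colour \<Rightarrow> colour" where
  "pv Col0 = Col2" | "pv Col1 = Col0" | "pv Col2 = Col1"

lemma nx_pv [simp]:
  "nx (pv k) = k" "pv (nx k) = k" "nx (nx k) = pv k" "pv (pv k) = nx k"
  by (cases k; simp)+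

lemma nx_neq [simp]:
  "nx k \<noteq> k" "k \<noteq> nx k" "pv k \<noteq> k" "k \<noteq> pv k" "nx k \<noteq> pv k" "pv k \<noteq> nx k"
  by (cases k; simp)+

lemma pv_inject [simp]: "pv k = pv l \<longleftrightarrow> k = l"
  by (cases k; cases l; simp)

lemma colour_cases: "l = k \<or> l = nx k \<or> l = pv k"
  by (cases k; cases l; simp)

lemma third_colour: "\<exists>m :: colour. m \<noteq> i \<and> m \<noteq> j"
  by (intro exI[of _ "if j = nx i then pv i else nx i"]) auto

lemma UNIV_colour: "(UNIV :: colour set) = {Col0, Col1, Col2}"
  using colour.exhaust by auto

instance colour :: finite
  by standard (simp add: UNIV_colour)

text \<open>\<open>unique_neighbour\<close> is prismaticity for a triangle indexed by its colours: a
  vertex off the triangle is not adjacent to the triangle's vertex of its own colour, so its only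
  neighbour is one of the other two. Since \<open>E\<close> is not tied to \<open>V\<close>, an
  induced subgraph changes \<open>V\<close> alone.\<close>

locale coloured_prism =
  fixes V :: "'a set" and E :: "'a \<Rightarrow> 'a \<Rightarrow> bool" and col :: "'a \<Rightarrow> colour"
  assumes finite_V: "finite V"
    and E_sym: "E x y \<Longrightarrow> E y x"
    and E_col: "x \<in> V \<Longrightarrow> y \<in> V \<Longrightarrow> E x y \<Longrightarrow> col x \<noteq> col y"
    and unique_neighbour:
      "(\<And>k. t k \<in> V \<and> col (t k) = k \<and> E (t k) (t (nx k))) \<Longrightarrow> v \<in> V \<Longrightarrow> v \<noteq> t (col v) \<Longrightarrow>
        E v (t (nx (col v))) \<longleftrightarrow> \<not> E v (t (pv (col v)))"
begin

definition tri :: "(colour \<Rightarrow> 'a) \<Rightarrow> bool" where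
  "tri t \<longleftrightarrow> (\<forall>k. t k \<in> V \<and> col (t k) = k \<and> E (t k) (t (nx k)))"

text \<open>
  The edges between two disjoint triangles form a perfect matching that shifts all colours in the
  same direction (\<open>disjoint_edge_iff\<close>); \<open>arr t u\<close> says that they shift from \<open>t\<close> to \<open>u\<close> by \<open>nx\<close>.
\<close>

definition arr :: "(colour \<Rightarrow> 'a) \<Rightarrow> (colour \<Rightarrow> 'a) \<Rightarrow> bool" where
  "arr t u \<longleftrightarrow> (\<forall>k. t k \<noteq> u k \<and> E (t k) (u (nx k)))"

definition used :: "(colour \<Rightarrow> 'a) \<Rightarrow> colour \<Rightarrow> bool" where
  "used t k \<longleftrightarrow> (\<exists>s. tri s \<and> s \<noteq> t \<and> s k = t k)"

text \<open>
  A grid is an induced copy of the line graph of \<open>K\<^bsub>3,3\<^esub>\<close>, which is isomorphic to its complement: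
  vertices are adjacent iff they differ in both coordinates, and the columns are the colour classes.
\<close>

definition grid :: "(colour \<Rightarrow> colour \<Rightarrow> 'a) \<Rightarrow> bool" where
  "grid g \<longleftrightarrow> (\<forall>i k. g i k \<in> V \<and> col (g i k) = k) \<and>
     (\<forall>i j k l. k \<noteq> l \<longrightarrow> (E (g i k) (g j l) \<longleftrightarrow> i \<noteq> j))"

lemma E_commute: "E x y \<longleftrightarrow> E y x"
  using E_sym by blast

lemma triD:
  assumes "tri t"
  shows "t k \<in> V" "col (t k) = k" "E (t k) (t (nx k))" "E (t k) (t (pv k))"
  using assms E_sym[of "t (pv k)" "t k"] unfolding tri_def by (metis nx_pv)+

lemma triI:
  assumes "\<And>l. t l \<in> V" "\<And>l. col (t l) = l"
    and "E (t k) (t (nx k))" "E (t (nx k)) (t (pv k))" "E (t (pv k)) (t k)"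
  shows "tri t"
  unfolding tri_def using assms colour_cases[of _ k] by (metis nx_pv)

lemma neighbour:
  assumes "tri t" "v \<in> V" "col v = k" "v \<noteq> t k"
  shows "E v (t (nx k)) \<longleftrightarrow> \<not> E v (t (pv k))"
  using unique_neighbour[of t v] assms unfolding tri_def by auto

lemma neighbour_tri:
  assumes "tri t" "tri u" "u k \<noteq> t k"
  shows "E (u k) (t (nx k)) \<longleftrightarrow> \<not> E (u k) (t (pv k))"
  using neighbour[OF assms(1), of "u k" k] assms triD by auto

text \<open>The remaining vertex of \<open>u\<close> is adjacent to both shared vertices; if it were
  off \<open>t\<close>, it would have two neighbours in \<open>t\<close>.\<close>

lemma tri_eqI:
  assumes t: "tri t" and u: "tri u" and "k \<noteq> l" "t k = u k" "t l = u l"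
  shows "t = u"
proof
  have *: "t m = u m" if "t (nx m) = u (nx m)" "t (pv m) = u (pv m)" for m
    using neighbour_tri[OF t u, of m] triD[OF u, of m] that by metis
  fix m
  show "t m = u m"
    using assms(3-5) *[of m] colour_cases[of k m] colour_cases[of l m] by metis
qed

lemma no_third:
  assumes t: "tri t" and "v \<in> V" "col v = k" "E v (t (nx k))" "E v (t (pv k))"
  shows "v = t k"
  using neighbour[OF assms(1-3)] assms(4,5) by blast

lemma disjoint_edge_iff:
  assumes t: "tri t" and u: "tri u" and d: "\<And>k. t k \<noteq> u k"
  shows "E (t k) (u (nx k)) \<longleftrightarrow> E (t l) (u (nx l))"
    and "E (t k) (u (pv k)) \<longleftrightarrow> \<not> E (t l) (u (nx l))"
proof -
  \<comment> \<open>The only neighbour of \<open>u (nx m)\<close> in \<open>t\<close> is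
    \<open>t m\<close>, so \<open>t (pv m)\<close> must go to \<open>u m\<close>. Then
    \<open>u m\<close> is not adjacent to \<open>t (nx m)\<close>, which therefore goes to
    \<open>u (pv m)\<close>.\<close>
  have *: "E (t (nx m)) (u (pv m))" if "E (t m) (u (nx m))" for m
    using neighbour_tri[OF u t, of "nx m"] neighbour_tri[OF t u, of "pv m"]
      neighbour_tri[OF u t, of "pv m"] neighbour_tri[OF t u, of "m"]
      neighbour_tri[OF u t, of m] neighbour_tri[OF t u, of "nx m"] that d E_commute
    by (metis nx_pv)
  have "E (t m) (u (nx m)) \<longleftrightarrow> E (t (nx m)) (u (pv m))" for m
    using *[of m] *[of "nx m"] *[of "pv m"] by auto
  then show 1: "E (t k) (u (nx k)) \<longleftrightarrow> E (t l) (u (nx l))" for k l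
    using colour_cases[of l k] by (metis nx_pv)
  show "E (t k) (u (pv k)) \<longleftrightarrow> \<not> E (t l) (u (nx l))"
    using neighbour_tri[OF u t, of k] d 1[of k l] by metis
qed

lemma arrI: "tri t \<Longrightarrow> tri u \<Longrightarrow> (\<And>k. t k \<noteq> u k) \<Longrightarrow> E (t k) (u (nx k)) \<Longrightarrow> arr t u"
  unfolding arr_def using disjoint_edge_iff(1) by metis

lemma arrD:
  assumes "arr t u"
  shows "t k \<noteq> u k" "u k \<noteq> t k" "E (t k) (u (nx k))" "E (u (nx k)) (t k)"
    "E (t (pv k)) (u k)" "E (u k) (t (pv k))"
  using assms E_sym unfolding arr_def by (metis nx_pv)+

lemma arr_not:
  assumes "tri t" "tri u" "arr t u"
  shows "\<not> E (t k) (u (pv k))" "\<not> E (u (pv k)) (t k)" "\<not> E (u k) (t (nx k))" "\<not> E (t (nx k)) (u k)"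
  using disjoint_edge_iff(2)[OF assms(1,2)] arrD[OF assms(3)] E_commute by (metis nx_pv)+

lemma arr_total: "tri t \<Longrightarrow> tri u \<Longrightarrow> (\<And>k. t k \<noteq> u k) \<Longrightarrow> arr t u \<or> arr u t"
  using arrI[of t u Col0] arrI[of u t Col2] disjoint_edge_iff(2)[of t u Col0 Col0] E_commute
  by (metis nx.simps(1,3) pv.simps(1))

lemma arr_asym: "tri t \<Longrightarrow> tri u \<Longrightarrow> arr t u \<Longrightarrow> \<not> arr u t"
  using arr_not(3)[of t u Col0] arrD(3)[of u t Col0] by blast

text \<open>The triangles \<open>t\<close>, \<open>u\<close>, \<open>w\<close> become the three broken diagonals of the grid.\<close>

lemma cyclic_grid:
  assumes t: "tri t" "tri u" "tri w" and a: "arr t u" "arr u w" "arr w t"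
  shows "\<exists>g. grid g"
proof -
  define g where "g = (\<lambda>i k. (case (i, k) of
      (Col0, Col0) \<Rightarrow> t | (Col1, Col1) \<Rightarrow> t | (Col2, Col2) \<Rightarrow> t
    | (Col1, Col0) \<Rightarrow> u | (Col2, Col1) \<Rightarrow> u | (Col0, Col2) \<Rightarrow> u
    | _ \<Rightarrow> w) k)"
  note facts = t[THEN triD(1)] t[THEN triD(2)]
  have e: "E (s Col0) (s Col1)" "E (s Col1) (s Col0)" "E (s Col1) (s Col2)" "E (s Col2) (s Col1)"
      "E (s Col2) (s Col0)" "E (s Col0) (s Col2)" if "tri s" for s
    using triD(3,4)[OF that, of Col0] triD(3,4)[OF that, of Col1] triD(3,4)[OF that, of Col2] by auto
  have n: "E (s Col0) (s' Col1)" "E (s Col1) (s' Col2)" "E (s Col2) (s' Col0)"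
      "E (s' Col1) (s Col0)" "E (s' Col2) (s Col1)" "E (s' Col0) (s Col2)"
      if "arr s s'" for s s'
    using arrD(3,4)[OF that, of Col0] arrD(3,4)[OF that, of Col1] arrD(3,4)[OF that, of Col2] by auto
  have m: "\<not> E (s' Col0) (s Col1)" "\<not> E (s' Col1) (s Col2)" "\<not> E (s' Col2) (s Col0)"
      "\<not> E (s Col1) (s' Col0)" "\<not> E (s Col2) (s' Col1)" "\<not> E (s Col0) (s' Col2)"
      if "arr s s'" "tri s" "tri s'" for s s'
    using arr_not(3,4)[OF that(2,3,1), of Col0] arr_not(3,4)[OF that(2,3,1), of Col1]
      arr_not(3,4)[OF that(2,3,1), of Col2] by auto
  have "g i k \<in> V \<and> col (g i k) = k" for i k
    using facts by (cases i; cases k; simp add: g_def)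
  moreover have "k \<noteq> l \<longrightarrow> (E (g i k) (g j l) \<longleftrightarrow> i \<noteq> j)" for i j k l
    by (cases i; cases j; cases k; cases l;
        simp add: g_def e[OF t(1)] e[OF t(2)] e[OF t(3)] n[OF a(1)] n[OF a(2)] n[OF a(3)]
          m[OF a(1) t(1,2)] m[OF a(2) t(2,3)] m[OF a(3) t(3,1)])
  ultimately show ?thesis unfolding grid_def by blast
qed

text \<open>The edge of \<open>t\<close> between the two shared vertices fixes the direction. The
  triangles are disjoint because a common vertex of colour \<open>pv k\<close> would be adjacent to
  both ends of that edge, hence be the third vertex of \<open>t\<close>.\<close>

lemma share_arr:
  assumes t: "tri t" and s: "tri s" "s \<noteq> t" "s k = t k" and u: "tri u" "u \<noteq> t" "u (nx k) = t (nx k)"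
  shows "arr s u"
proof (rule arrI[OF s(1) u(1), where k = k])
  have "s k \<noteq> u k" using tri_eqI[OF u(1) t, of k "nx k"] u s by auto
  moreover have "s (nx k) \<noteq> u (nx k)" using tri_eqI[OF s(1) t, of k "nx k"] u s by auto
  moreover have "s (pv k) \<noteq> u (pv k)"
  proof
    assume eq: "s (pv k) = u (pv k)"
    have "E (s (pv k)) (t k)" using triD(3)[OF s(1), of "pv k"] s by simp
    moreover have "E (s (pv k)) (t (nx k))" using triD(4)[OF u(1), of "pv k"] u eq by simp
    ultimately have "s (pv k) = t (pv k)" using no_third[OF t, of "s (pv k)" "pv k"] triD[OF s(1)] by simp
    then show False using tri_eqI[OF s(1) t, of k "pv k"] s by auto
  qed
  ultimately show "s l \<noteq> u l" for l using colour_cases[of l k] by auto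
  show "E (s k) (u (nx k))" using s u triD[OF t] by simp
qed

lemma used_all_grid:
  assumes t: "tri t" and "\<And>k. used t k"
  shows "\<exists>g. grid g"
proof -
  obtain s where s: "\<And>k. tri (s k) \<and> s k \<noteq> t \<and> s k k = t k"
    using assms(2) unfolding used_def by metis
  have "arr (s k) (s (nx k))" for k
    using share_arr[OF t, of "s k" k "s (nx k)"] s by metis
  then show ?thesis using cyclic_grid s by (metis nx_pv(3) nx_pv(1))
qed

section \<open>Hitting sets and packings without a grid\<close>

text \<open>
  Four triangles in cyclic position, which form a grid with one vertex missing.
\<close>

definition cyc4 :: "colour \<Rightarrow> (colour \<Rightarrow> 'a) \<Rightarrow> (colour \<Rightarrow> 'a) \<Rightarrow> (colour \<Rightarrow> 'a) \<Rightarrow> (colour \<Rightarrow> 'a) \<Rightarrow> bool"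
  where "cyc4 k t t' s s' \<longleftrightarrow> tri t \<and> tri t' \<and> tri s \<and> tri s' \<and> t k \<noteq> t' k \<and>
     t k = s k \<and> t' k = s' k \<and> t (nx k) = t' (nx k) \<and> s (pv k) = s' (pv k) \<and> s \<noteq> t \<and> s' \<noteq> t'"

lemma cyc4_swap: "cyc4 k t t' s s' \<Longrightarrow> cyc4 k t' t s' s"
  unfolding cyc4_def by auto

text \<open>Opposite triangles of the cycle are disjoint. Each pair is oriented by an edge of
  \<open>t\<close> or \<open>t'\<close>, from its vertex of colour \<open>k\<close> to the shared
  vertex of colour \<open>nx k\<close>.\<close>

lemma cyc4_edges:
  assumes "cyc4 k t t' s s'"
  shows "tri t" "tri t'" "tri s" "tri s'"
    and "t k \<noteq> t' k" "s k = t k" "s' k = t' k" "t' (nx k) = t (nx k)" "s' (pv k) = s (pv k)"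
    and "s (nx k) \<noteq> t (nx k)" "s' (nx k) \<noteq> t (nx k)" "s (nx k) \<noteq> s' (nx k)"
    and "t (pv k) \<noteq> s (pv k)" "t' (pv k) \<noteq> s (pv k)" "t (pv k) \<noteq> t' (pv k)"
    and "arr s t'" "arr s' t"
proof -
  show T: "tri t" "tri t'" "tri s" "tri s'"
    and e: "t k \<noteq> t' k" "s k = t k" "s' k = t' k" "t' (nx k) = t (nx k)" "s' (pv k) = s (pv k)"
    using assms unfolding cyc4_def by auto
  have n: "s \<noteq> t" "s' \<noteq> t'" "t \<noteq> t'" "s \<noteq> s'"
    using assms unfolding cyc4_def by auto
  show n1: "s (nx k) \<noteq> t (nx k)" and "t (pv k) \<noteq> s (pv k)"
    using tri_eqI[OF T(3,1), of k "nx k"] tri_eqI[OF T(3,1), of k "pv k"] n e by auto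
  show n2: "s' (nx k) \<noteq> t (nx k)" and n3: "t' (pv k) \<noteq> s (pv k)"
    using tri_eqI[OF T(4,2), of k "nx k"] tri_eqI[OF T(4,2), of k "pv k"] n e by auto
  show "s (nx k) \<noteq> s' (nx k)"
    using tri_eqI[OF T(3,4), of "nx k" "pv k"] n e by fastforce
  show "t (pv k) \<noteq> t' (pv k)"
    using tri_eqI[OF T(1,2), of "nx k" "pv k"] n e by fastforce
  have "s l \<noteq> t' l" "s' l \<noteq> t l" for l
    using colour_cases[of l k] e n1 n2 n3 \<open>t (pv k) \<noteq> s (pv k)\<close> by metis+
  then show "arr s t'" "arr s' t"
    using arrI[OF T(3,2), of k] arrI[OF T(4,1), of k] triD(3)[OF T(1), of k] triD(3)[OF T(2), of k] e
    by metis+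
qed

text \<open>If \<open>u\<close> passed through \<open>t k\<close>, its other two vertices would both
  be adjacent to \<open>t' k\<close>: the one of colour \<open>nx k\<close> by comparing
  \<open>s\<close> with \<open>s'\<close>, the other by comparing \<open>t\<close> with
  \<open>t'\<close>. Then \<open>t' k\<close> would be the vertex \<open>t k\<close> of
  \<open>u\<close>.\<close>

lemma cyc4_avoid_k:
  assumes q: "cyc4 k t t' s s'" and u: "tri u" "u (nx k) \<noteq> t (nx k)" "u (pv k) \<noteq> s (pv k)"
  shows "u k \<noteq> t k"
proof
  assume eq: "u k = t k"
  note Q = cyc4_edges[OF q]
  let ?b = "u (nx k)" and ?c = "u (pv k)"
  have ad: "E ?b (t k)" "E ?c (t k)" "E ?b ?c"
    using triD(3,4)[OF u(1), of "nx k"] triD(3)[OF u(1), of "pv k"] eq by auto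
  have "?b \<noteq> s' (nx k)"
    using ad(1) arr_not(4)[OF Q(4,1) Q(17), of k] by auto
  moreover have "?b \<noteq> s (nx k)"
    using tri_eqI[OF u(1) Q(3), of k "nx k"] eq u(3) Q(6) by auto
  ultimately have b: "E ?b (t' k)"
    using neighbour_tri[OF Q(3) u(1), of "nx k"] neighbour_tri[OF Q(4) u(1), of "nx k"] ad(1) Q(6,7,9)
    by auto
  have "?c \<noteq> t' (pv k)"
    using ad(2) arr_not(2)[OF Q(3,2) Q(16), of k] Q(6) by auto
  moreover have "?c \<noteq> t (pv k)"
    using tri_eqI[OF u(1) Q(1), of k "pv k"] eq u(2) by auto
  ultimately have c: "E ?c (t' k)"
    using neighbour_tri[OF Q(1) u(1), of "pv k"] neighbour_tri[OF Q(2) u(1), of "pv k"] ad(2) Q(8)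
    by auto
  have "t' k = u k"
    using no_third[OF u(1), of "t' k" k] b c triD[OF Q(2)] E_commute by auto
  then show False using eq Q(5) by simp
qed

text \<open>This allows \<open>t (nx k)\<close> and \<open>s (pv k)\<close> to be split off against
  the disjoint triangles \<open>s\<close> and \<open>t'\<close>. After \<open>cyc4_avoid_k\<close>,
  only \<open>s (nx k)\<close> and \<open>t' (pv k)\<close> remain to be excluded (\<open>x\<close>
  and \<open>z\<close>): containing one of them would complete a grid or give a vertex off
  \<open>u\<close> two neighbours in \<open>u\<close>.\<close>

lemma cyc4_avoid:
  assumes ng: "\<nexists>g. grid g" and q: "cyc4 k t t' s s'"
    and u: "tri u" "u (nx k) \<noteq> t (nx k)" "u (pv k) \<noteq> s (pv k)"
  shows "u l \<noteq> s l" "u l \<noteq> t' l"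
proof -
  note Q = cyc4_edges[OF q]
  have k1: "u k \<noteq> t k" using cyc4_avoid_k[OF q u] .
  have k2: "u k \<noteq> t' k" using cyc4_avoid_k[OF cyc4_swap[OF q] u(1)] u Q by simp
  let ?a = "u k" and ?b = "u (nx k)" and ?c = "u (pv k)"
  have ad: "E ?a ?b" "E ?b ?a" "E ?b ?c" "E ?c ?b" "E ?a ?c" "E ?c ?a"
    using triD(3,4)[OF u(1), of k] triD(3,4)[OF u(1), of "nx k"] triD(3,4)[OF u(1), of "pv k"] by auto
  note nt = neighbour_tri[OF Q(1) u(1)] and nt' = neighbour_tri[OF Q(2) u(1)]
    and ns = neighbour_tri[OF Q(3) u(1)] and ns' = neighbour_tri[OF Q(4) u(1)]
  have x: "?b \<noteq> s (nx k)"
  proof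
    assume eq: "?b = s (nx k)"
    have a1: "E ?a (s' (nx k))"
      using ns[of k] ns'[of k] ad(1) eq k1 k2 Q(6,7,9) by simp
    show False
    proof (cases "?c = t' (pv k)")
      case True
      have a2: "E ?a (t (pv k))"
        using nt'[of k] nt[of k] ad(5) True k1 k2 Q(8) by simp
      \<comment> \<open>Here \<open>u k\<close> is the missing ninth vertex of the grid, and
        \<open>w\<close> is the third broken diagonal, closing the cycle \<open>t'\<close>,
        \<open>w\<close>, \<open>s\<close>.\<close>
      define w where "w = (\<lambda>l. if l = k then ?a else if l = nx k then s' l else t l)"
      have w: "w k = ?a" "w (nx k) = s' (nx k)" "w (pv k) = t (pv k)"
        by (auto simp: w_def)
      have wt: "tri w"
      proof (rule triI[where k = k])
        show "w l \<in> V" "col (w l) = l" for l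
          using triD[OF u(1)] triD[OF Q(1)] triD[OF Q(4)] by (auto simp: w_def)
        show "E (w k) (w (nx k))" "E (w (pv k)) (w k)"
          using a1 a2 w E_commute by auto
        show "E (w (nx k)) (w (pv k))"
          using arrD(3)[OF Q(17), of "nx k"] w by simp
      qed
      have "arr t' w"
      proof (rule arrI[OF Q(2) wt])
        show "t' l \<noteq> w l" for l
          using colour_cases[of l k] w k2 Q(8,11,15) by metis
        show "E (t' k) (w (nx k))" using triD(3)[OF Q(4), of k] w Q(7) by simp
      qed
      moreover have "arr w s"
      proof (rule arrI[OF wt Q(3)])
        show "w l \<noteq> s l" for l
          using colour_cases[of l k] w k1 Q(6,12,13) by metis
        show "E (w k) (s (nx k))" using ad eq w by simp
      qed
      ultimately show False using cyclic_grid[OF Q(3,2) wt] Q(16) ng by blast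
    next
      case False
      have "?c \<noteq> t (pv k)"
        using ad(4) eq arr_not(4)[OF Q(3,2) Q(16)] Q triD ns[of "pv k"] triD(4)[OF Q(1), of k]
        by (metis E_commute nx_pv)
      then have "E ?c (s' (nx k))"
        using ns[of "pv k"] nt[of "pv k"] nt'[of "pv k"] ns'[of "pv k"] ad(4) eq False u Q by auto
      then have "s' (nx k) = ?b"
        using no_third[OF u(1), of "s' (nx k)" "nx k"] a1 triD[OF Q(4)] E_commute by auto
      then show False using eq Q(12) by simp
    qed
  qed
  have z: "?c \<noteq> t' (pv k)"
  proof
    assume eq: "?c = t' (pv k)"
    have a: "E ?a (t (pv k))"
      using nt'[of k] nt[of k] ad(5) eq k1 k2 Q(8) by simp
    have "\<not> E ?b (t' k)"
      using nt'[of "nx k"] ad(3) eq u Q(8) by auto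
    moreover from this have "?b \<noteq> s' (nx k)"
      using Q(7) triD(4)[OF Q(4), of "nx k"] by auto
    ultimately have "E ?b (s' (pv k))"
      using ns'[of "nx k"] Q(7) by auto
    then have "E ?b (t (pv k))"
      using ns[of "nx k"] nt[of "nx k"] x u Q by auto
    then have "t (pv k) = ?c"
      using no_third[OF u(1), of "t (pv k)" "pv k"] a triD[OF Q(1)] E_commute by auto
    then show False using eq Q(15) by simp
  qed
  show "u l \<noteq> s l" "u l \<noteq> t' l"
    using colour_cases[of l k] k1 k2 x z u Q by metis+
qed

lemma finite_tri: "finite {t. tri t}"
proof (rule finite_subset)
  show "{t. tri t} \<subseteq> (UNIV :: colour set) \<rightarrow>\<^sub>E V"
    using triD(1) by (auto simp: PiE_UNIV_domain)
  show "finite ((UNIV :: colour set) \<rightarrow>\<^sub>E V)"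
    by (rule finite_PiE) (auto simp: finite_V)
qed

text \<open>Let \<open>s\<close> and \<open>s'\<close> meet \<open>t\<close> and \<open>t'\<close>
  in colour \<open>k\<close>. By \<open>share_arr\<close>, \<open>s\<close> points to
  \<open>t'\<close> and \<open>s'\<close> to \<open>t\<close>. If \<open>s\<close> and
  \<open>s'\<close> were disjoint, the edges at the shared vertices would orient them both ways; so
  they meet, and only colour \<open>pv k\<close> is possible.\<close>

lemma used_next_or_cyc4:
  assumes ng: "\<nexists>g. grid g" and t: "tri t" "used t k"
    and t': "tri t'" "t' \<noteq> t" "t' (nx k) = t (nx k)" "used t' k"
  shows "\<exists>s s'. cyc4 k t t' s s'"
proof -
  obtain s where s: "tri s" "s \<noteq> t" "s k = t k" using t(2) unfolding used_def by blast
  obtain s' where s': "tri s'" "s' \<noteq> t'" "s' k = t' k" using t'(4) unfolding used_def by blast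
  have st': "arr s t'" using share_arr[OF t(1) s t'(1-3)] .
  have s't: "arr s' t" using share_arr[OF t'(1) s' t(1)] t'(2,3) by auto
  have ne: "t k \<noteq> t' k" using tri_eqI[OF t(1) t'(1), of k "nx k"] t' by auto
  have "\<not> (\<forall>l. s l \<noteq> s' l)"
  proof
    assume d: "\<forall>l. s l \<noteq> s' l"
    have "arr s' s"
      using arrI[OF s'(1) s(1), of "pv k"] d arrD(5)[OF s't, of k] s(3) by (metis nx_pv(1))
    moreover have "arr s s'"
      using arrI[OF s(1) s'(1), of "pv k"] d arrD(5)[OF st', of k] s'(3) by (metis nx_pv(1))
    ultimately show False using arr_asym s(1) s'(1) by blast
  qed
  then obtain l where l: "s l = s' l" by blast
  have "l \<noteq> k" using l ne s(3) s'(3) by auto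
  moreover have "l \<noteq> nx k"
  proof
    assume "l = nx k"
    then have "E (s' (nx k)) (t k)" using l triD(4)[OF s(1), of "nx k"] s(3) by simp
    then show False using arr_not(4)[OF s'(1) t(1) s't, of k] by simp
  qed
  ultimately have "l = pv k" using colour_cases[of l k] by blast
  then show ?thesis using l s s' t t' ne unfolding cyc4_def by metis
qed

text \<open>
  A triangle \<open>t\<close> with the largest number of \<open>arr\<close>-predecessors works: otherwise \<open>t\<close> meets others exactly at
  colours \<open>k\<close> and \<open>nx k\<close>, and a triangle \<open>t'\<close> sharing the vertex of colour \<open>nx k\<close> has strictly more.
\<close>

lemma simplicial_tri:
  assumes ng: "\<nexists>g. grid g" and nq: "\<nexists>k t t' s s'. cyc4 k t t' s s'" and ex: "\<exists>t. tri t"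
  shows "\<exists>t k. tri t \<and> (\<forall>l. l \<noteq> k \<longrightarrow> \<not> used t l)"
proof (rule ccontr)
  assume no: "\<not> ?thesis"
  \<comment> \<open>Three used colours give a grid and at most one is the claim, so exactly two are
    used; any two colours are cyclically consecutive.\<close>
  have two: "\<exists>k. used t k \<and> used t (nx k) \<and> \<not> used t (pv k)" if t: "tri t" for t
  proof -
    obtain m where "\<not> used t m" using used_all_grid[OF t] ng by blast
    moreover obtain l where "l \<noteq> nx m" "used t l" using no t by blast
    moreover obtain l' where "l' \<noteq> pv m" "used t l'" using no t by blast
    ultimately have "used t (nx m) \<and> used t (pv m)"
      using colour_cases[of l m] colour_cases[of l' m] by metis
    then show ?thesis using \<open>\<not> used t m\<close> by (intro exI[of _ "nx m"]) simp
  qed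
  define P where "P = (\<lambda>t. {s. tri s \<and> arr s t})"
  have finP: "finite (P t)" for t using finite_tri by (rule rev_finite_subset) (auto simp: P_def)
  have "\<exists>t'. tri t' \<and> P t \<subset> P t'" if t: "tri t" for t
  proof -
    obtain k where k: "used t k" "used t (nx k)" "\<not> used t (pv k)" using two[OF t] by blast
    obtain t' where t': "tri t'" "t' \<noteq> t" "t' (nx k) = t (nx k)" using k(2) unfolding used_def by blast
    obtain s0 where s0: "tri s0" "s0 \<noteq> t" "s0 k = t k" using k(1) unfolding used_def by blast
    have nk: "\<not> used t' k" using used_next_or_cyc4[OF ng t k(1) t'] nq by blast
    \<comment> \<open>A predecessor of \<open>t\<close> could meet \<open>t'\<close> only in colour
      \<open>pv k\<close>, and then \<open>share_arr\<close> around \<open>t'\<close> would make it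
      a successor of \<open>t\<close>. The inclusion is strict because \<open>s0\<close> meets
      \<open>t\<close> but points to \<open>t'\<close>.\<close>
    have "s \<in> P t'" if s: "s \<in> P t" for s
    proof -
      have S: "tri s" "arr s t" using s by (auto simp: P_def)
      have st: "s \<noteq> t" "s \<noteq> t'" using arrD(1)[OF S(2)] t'(3) by auto
      have "s l \<noteq> t' l" for l
      proof
        assume eq: "s l = t' l"
        have "l \<noteq> k" using nk eq S st unfolding used_def by auto
        moreover have "l \<noteq> nx k" using eq arrD(1)[OF S(2)] t'(3) by auto
        ultimately have l: "l = pv k" using colour_cases[of l k] by blast
        have "arr t s"
          using share_arr[OF t'(1) t _ _ S(1), of "nx k"] t' st eq l by auto
        then show False using arr_asym S t by blast
      qed
      then have "arr s t'"
        using arrI[OF S(1) t'(1), of k] arrD(3)[OF S(2), of k] t'(3) by auto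
      then show ?thesis using S by (simp add: P_def)
    qed
    moreover have "s0 \<in> P t'" using share_arr[OF t s0 t'] s0 by (simp add: P_def)
    moreover have "s0 \<notin> P t" using s0(3) arrD(1)[of s0 t k] by (auto simp: P_def)
    ultimately show ?thesis using t'(1) by blast
  qed
  then have step: "\<exists>t'. tri t' \<and> card (P t) < card (P t')" if "tri t" for t
    using that psubset_card_mono[OF finP] by meson
  let ?S = "(\<lambda>t. card (P t)) ` {t. tri t}"
  have "finite ?S" "?S \<noteq> {}" using finite_tri ex by auto
  then obtain t where "tri t" "card (P t) = Max ?S"
    using Max_in[of ?S] by (metis (mono_tags, lifting) imageE mem_Collect_eq)
  moreover obtain t' where "tri t'" "card (P t) < card (P t')" using step calculation(1) by blast
  moreover have "card (P t') \<le> Max ?S" using \<open>finite ?S\<close> \<open>tri t'\<close> by (intro Max_ge) auto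
  ultimately show False by simp
qed

section \<open>Induced subgraphs, hitting sets and packings\<close>

lemma restrict:
  assumes "W \<subseteq> V"
  shows "coloured_prism W E col"
proof
  show "finite W" using assms finite_V finite_subset by blast
  show "E y x" if "E x y" for x y using that E_sym by blast
  show "col x \<noteq> col y" if "x \<in> W" "y \<in> W" "E x y" for x y using that assms E_col by blast
  fix t v
  assume *: "\<And>k. t k \<in> W \<and> col (t k) = k \<and> E (t k) (t (nx k))" and "v \<in> W" "v \<noteq> t (col v)"
  have "tri t" using * assms unfolding tri_def by blast
  then show "E v (t (nx (col v))) \<longleftrightarrow> \<not> E v (t (pv (col v)))"
    using neighbour \<open>v \<in> W\<close> \<open>v \<noteq> t (col v)\<close> assms by blast
qed

lemma restrict_tri:
  assumes "W \<subseteq> V"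
  shows "coloured_prism.tri W E col t \<longleftrightarrow> tri t \<and> range t \<subseteq> W"
  using assms unfolding coloured_prism.tri_def[OF restrict[OF assms]] tri_def by auto

lemma restrict_grid:
  assumes "W \<subseteq> V"
  shows "coloured_prism.grid W E col g \<longleftrightarrow> grid g \<and> (\<forall>i. range (g i) \<subseteq> W)"
  using assms unfolding coloured_prism.grid_def[OF restrict[OF assms]] grid_def by fast

definition hits :: "'a set \<Rightarrow> bool" where
  "hits X \<longleftrightarrow> X \<subseteq> V \<and> (\<forall>t. tri t \<longrightarrow> range t \<inter> X \<noteq> {})"

definition packing :: "(colour \<Rightarrow> 'a) set \<Rightarrow> bool" where
  "packing F \<longleftrightarrow> (\<forall>t\<in>F. tri t) \<and> (\<forall>t\<in>F. \<forall>u\<in>F. t \<noteq> u \<longrightarrow> (\<forall>k. t k \<noteq> u k))"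

lemma finite_packing: "packing F \<Longrightarrow> finite F"
  using finite_tri by (rule rev_finite_subset) (auto simp: packing_def)

lemma restrict_hits:
  assumes "W \<subseteq> V"
  shows "coloured_prism.hits W E col X \<longleftrightarrow>
    X \<subseteq> W \<and> (\<forall>t. tri t \<longrightarrow> range t \<subseteq> W \<longrightarrow> range t \<inter> X \<noteq> {})"
  unfolding coloured_prism.hits_def[OF restrict[OF assms]] restrict_tri[OF assms] by blast

lemma restrict_packing:
  assumes "W \<subseteq> V"
  shows "coloured_prism.packing W E col F \<longleftrightarrow> packing F \<and> (\<forall>t\<in>F. range t \<subseteq> W)"
  unfolding coloured_prism.packing_def[OF restrict[OF assms]] restrict_tri[OF assms] packing_def
  by blast

text \<open>The step of the min-max induction: after deleting \<open>Y\<close>, the set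
  \<open>Y\<close> is added to the hitting set and \<open>G\<close> to the packing. By
  \<open>d\<close>, the triangles that survive the deletion are disjoint from those in
  \<open>G\<close>.\<close>

lemma hits_packing_extend:
  assumes W: "W = V - Y" "Y \<subseteq> V"
    and X: "coloured_prism.hits W E col X" and F: "coloured_prism.packing W E col F"
    and G: "packing G" and Y: "card Y \<le> card G" "\<And>t. t \<in> G \<Longrightarrow> range t \<inter> Y \<noteq> {}"
    and d: "\<And>t u. tri u \<Longrightarrow> range u \<inter> Y = {} \<Longrightarrow> t \<in> G \<Longrightarrow> (\<forall>k. u k \<noteq> t k)"
    and c: "card X \<le> card F"
  shows "hits (X \<union> Y) \<and> packing (F \<union> G) \<and> card (X \<union> Y) \<le> card (F \<union> G)"
proof -
  have WV: "W \<subseteq> V" using W by blast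
  note X' = X[unfolded restrict_hits[OF WV]] and F' = F[unfolded restrict_packing[OF WV]]
  have "hits (X \<union> Y)"
    unfolding hits_def
  proof (intro conjI allI impI)
    show "X \<union> Y \<subseteq> V" using X' W by blast
    fix t assume t: "tri t"
    then have "range t \<subseteq> V" using triD(1) by blast
    then show "range t \<inter> (X \<union> Y) \<noteq> {}"
      using X' t W by blast
  qed
  moreover have d': "\<forall>k. u k \<noteq> t k" if "u \<in> F" "t \<in> G" for t u
    using d[of u t] that F' W unfolding packing_def by blast
  then have "packing (F \<union> G)"
    using F' G unfolding packing_def by (metis Un_iff)
  moreover have "F \<inter> G = {}" using d' by blast
  then have "card (F \<union> G) = card F + card G"
    using finite_packing F' G by (simp add: card_Un_disjoint)
  ultimately show ?thesis using c Y card_Un_le[of X Y] by simp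
qed

end

text \<open>The opposite inequality is clear, since disjoint triangles need different hitting
  vertices. The induction removes one vertex of a simplicial triangle or two vertices of a
  \<open>cyc4\<close>; it varies \<open>V\<close>, hence the formulation outside the locale.\<close>

theorem hitting_eq_packing:
  assumes "coloured_prism V E col" "\<nexists>g. coloured_prism.grid V E col g"
  shows "\<exists>X F. coloured_prism.hits V E col X \<and> coloured_prism.packing V E col F \<and> card X \<le> card F"
  using assms
proof (induction "card V" arbitrary: V rule: less_induct)
  case less
  interpret coloured_prism V E col by fact
  note ng = less.prems(2)
  have IH: "\<exists>X F. coloured_prism.hits W E col X \<and> coloured_prism.packing W E col F \<and> card X \<le> card F"
    if "W = V - Y" "Y \<subseteq> V" "Y \<noteq> {}" for W Y
  proof (rule less.hyps)
    have "W \<subset> V" using that by blast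
    then show "card W < card V" using finite_V psubset_card_mono by blast
    show "coloured_prism W E col" "\<nexists>g. coloured_prism.grid W E col g"
      using restrict restrict_grid[of W] ng \<open>W \<subset> V\<close> by auto
  qed
  have step: ?case if Y: "Y \<subseteq> V" "Y \<noteq> {}" and G: "packing G" "card Y \<le> card G"
    "\<And>t. t \<in> G \<Longrightarrow> range t \<inter> Y \<noteq> {}"
    "\<And>t u. tri u \<Longrightarrow> range u \<inter> Y = {} \<Longrightarrow> t \<in> G \<Longrightarrow> (\<forall>k. u k \<noteq> t k)" for Y G
    using IH[OF refl Y] hits_packing_extend[OF refl Y(1) _ _ G] by blast
  consider (none) "\<nexists>t. tri t" | (cyc4) k t t' s s' where "cyc4 k t t' s s'"
    | (simplicial) t k where "tri t" "\<forall>l. l \<noteq> k \<longrightarrow> \<not> used t l"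
    using simplicial_tri[OF ng] by blast
  then show ?case
  proof cases
    case none
    then have "hits {}" "packing {}" by (auto simp: hits_def packing_def)
    then show ?thesis by fastforce
  next
    case cyc4
    note Q = cyc4_edges[OF cyc4]
    show ?thesis
    proof (rule step[of "{t (nx k), s (pv k)}" "{s, t'}"])
      show "{t (nx k), s (pv k)} \<subseteq> V" using triD(1) Q by auto
      show "packing {s, t'}" using Q arrD[OF Q(16)] by (auto simp: packing_def)
      have "s \<noteq> t'" using Q by auto
      then show "card {t (nx k), s (pv k)} \<le> card {s, t'}"
        using card_insert_le_m1[of 2 "{s (pv k)}" "t (nx k)"] by simp
      show "range u \<inter> {t (nx k), s (pv k)} \<noteq> {}" if "u \<in> {s, t'}" for u
        using that Q(8) by (metis IntI empty_iff insert_iff rangeI)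
      show "\<forall>l. u l \<noteq> w l" if "tri u" "range u \<inter> {t (nx k), s (pv k)} = {}" "w \<in> {s, t'}" for u w
      proof -
        have "u (nx k) \<noteq> t (nx k)" "u (pv k) \<noteq> s (pv k)"
          using that(2) by (metis IntI empty_iff insert_iff rangeI)+
        then show ?thesis using cyc4_avoid[OF ng cyc4 that(1)] that(3) by blast
      qed
    qed simp
  next
    case simplicial
    show ?thesis
    proof (rule step[of "{t k}" "{t}"])
      show "\<forall>l. u l \<noteq> w l" if "tri u" "range u \<inter> {t k} = {}" "w \<in> {t}" for u w
      proof -
        have "u k \<noteq> t k" using that(2) by (metis IntI empty_iff insert_iff rangeI)
        then show ?thesis using simplicial that unfolding used_def by fastforce
      qed
    qed (use simplicial triD in \<open>auto simp: packing_def\<close>)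
  qed
qed

section \<open>Grids\<close>

context coloured_prism
begin

text \<open>On a packing \<open>arr\<close> is a tournament, without cyclic triples by
  \<open>cyclic_grid\<close>, hence a linear order. The list is built by insertion.\<close>

lemma packing_chain:
  assumes ng: "\<nexists>g. grid g" and F: "packing F"
  shows "\<exists>xs. set xs = F \<and> sorted_wrt arr xs"
proof -
  have ins: "\<exists>ys. set ys = insert x (set xs) \<and> sorted_wrt arr ys"
    if "sorted_wrt arr xs" "x \<notin> set xs" "packing (insert x (set xs))" for x xs
    using that
  proof (induction xs)
    case Nil
    show ?case by (intro exI[of _ "[x]"]) simp
  next
    case (Cons y ys)
    have tri: "tri u" if "u \<in> insert x (set (y # ys))" for u
      using that Cons.prems(3) unfolding packing_def by blast
    have dis: "u l \<noteq> w l" if "u \<in> insert x (set (y # ys))" "w \<in> insert x (set (y # ys))" "u \<noteq> w" for u w l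
      using that Cons.prems(3) unfolding packing_def by blast
    consider "arr x y" | "arr y x"
      using arr_total[of x y] tri dis[of x y] Cons.prems(2) by auto
    then show ?case
    proof cases
      case 1
      have "arr x w" if w: "w \<in> set ys" for w
      proof (rule ccontr)
        assume "\<not> arr x w"
        moreover have "x \<noteq> w" using w Cons.prems(2) by auto
        ultimately have "arr w x"
          using arr_total[of x w] tri dis[of x w] w by auto
        moreover have "arr y w" using Cons.prems(1) w by simp
        ultimately show False
          using cyclic_grid[of x y w] tri w 1 ng by auto
      qed
      then have "sorted_wrt arr (x # y # ys)" using Cons.prems(1) 1 by auto
      then show ?thesis by (intro exI[of _ "x # y # ys"]) simp
    next
      case 2
      have "packing (insert x (set ys))"
        using Cons.prems(3) unfolding packing_def by auto
      then obtain zs where zs: "set zs = insert x (set ys)" "sorted_wrt arr zs"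
        using Cons by auto
      then have "sorted_wrt arr (y # zs)" using Cons.prems(1) 2 by auto
      then show ?thesis using zs by (intro exI[of _ "y # zs"]) auto
    qed
  qed
  show ?thesis
    using finite_packing[OF F] F
  proof (induction F rule: finite_induct)
    case empty
    show ?case by (intro exI[of _ "[]"]) simp
  next
    case (insert x F)
    then have "packing F" unfolding packing_def by blast
    then show ?case using ins insert by metis
  qed
qed

section \<open>Vertices and triangles relative to a grid\<close>

lemma gridD:
  assumes "grid g"
  shows "g i k \<in> V" "col (g i k) = k" "k \<noteq> l \<Longrightarrow> E (g i k) (g j l) \<longleftrightarrow> i \<noteq> j"
  using assms unfolding grid_def by blast+

lemma grid_inject:
  assumes "grid g"
  shows "g i k = g j l \<longleftrightarrow> i = j \<and> k = l"
proof
  assume eq: "g i k = g j l"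
  then have "k = l" using gridD(2)[OF assms] by metis
  moreover from this have "i = j"
    using eq gridD(3)[OF assms, of k "nx k" i i] gridD(3)[OF assms, of k "nx k" j i]
    by (metis nx_neq(2))
  ultimately show "i = j \<and> k = l" by blast
qed simp

lemma same_col: "x \<in> V \<Longrightarrow> y \<in> V \<Longrightarrow> col x = col y \<Longrightarrow> \<not> E x y"
  using E_col by blast

definition cells :: "(colour \<Rightarrow> colour \<Rightarrow> 'a) \<Rightarrow> 'a set" where
  "cells g = {g i k |i k. True}"

text \<open>Only meaningful for \<open>v\<close> outside the grid; any row can be used instead of \<open>Col0\<close>, see \<open>attach\<close>.\<close>

definition after :: "(colour \<Rightarrow> colour \<Rightarrow> 'a) \<Rightarrow> 'a \<Rightarrow> bool" where
  "after g v \<longleftrightarrow> E v (g Col0 (pv (col v)))"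

lemma cellsI [simp]: "g i k \<in> cells g"
  by (auto simp: cells_def)

lemma in_cells:
  assumes "grid g" "v \<in> cells g"
  obtains i where "v = g i (col v)"
  using assms gridD(2)[OF assms(1)] by (auto simp: cells_def)

lemma grid_tri:
  assumes "grid g" "\<And>k. f k \<noteq> f (nx k)"
  shows "tri (\<lambda>k. g (f k) k)"
  using assms gridD[OF assms(1)] unfolding tri_def by simp

text \<open>For rows \<open>i\<close> and \<open>j\<close> that differ, some triangle of the grid
  contains \<open>g i (nx k)\<close> and \<open>g j (pv k)\<close>, so \<open>v\<close> is adjacent
  to exactly one of them. With three rows available, adjacency is constant along each of these two
  columns.\<close>

lemma attach:
  assumes g: "grid g" and v: "v \<in> V" "v \<notin> cells g" "col v = k"
  shows "E v (g i (pv k)) \<longleftrightarrow> after g v" "E v (g i (nx k)) \<longleftrightarrow> \<not> after g v"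
    and "E (g i (pv k)) v \<longleftrightarrow> after g v" "E (g i (nx k)) v \<longleftrightarrow> \<not> after g v"
proof -
  have diff: "E v (g i (nx k)) \<longleftrightarrow> \<not> E v (g j (pv k))" if "i \<noteq> j" for i j
  proof -
    obtain m where m: "m \<noteq> i" "m \<noteq> j" using third_colour by blast
    define f where "f = (\<lambda>l. if l = k then m else if l = nx k then i else j)"
    have f: "f k = m" "f (nx k) = i" "f (pv k) = j" by (auto simp: f_def)
    have "tri (\<lambda>k. g (f k) k)"
    proof (rule grid_tri[OF g])
      fix l show "f l \<noteq> f (nx l)"
        using colour_cases[of l k] m that f by (elim disjE) simp_all
    qed
    moreover have "v \<noteq> g (f k) k" using v cellsI by blast
    ultimately show ?thesis
      using neighbour[of "\<lambda>k. g (f k) k" v k] v f by simp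
  qed
  have p: "E v (g i (pv k)) \<longleftrightarrow> after g v" for i
  proof -
    obtain m where m: "m \<noteq> i" "m \<noteq> Col0" using third_colour by blast
    show ?thesis using diff[OF m(1)] diff[OF m(2)] unfolding after_def v(3) by blast
  qed
  then have n: "E v (g i (nx k)) \<longleftrightarrow> \<not> after g v" for i
    using diff[of i "nx i"] by simp
  show "E v (g i (pv k)) \<longleftrightarrow> after g v" "E v (g i (nx k)) \<longleftrightarrow> \<not> after g v"
    and "E (g i (pv k)) v \<longleftrightarrow> after g v" "E (g i (nx k)) v \<longleftrightarrow> \<not> after g v"
    using p n E_commute by blast+
qed

text \<open>Suppose \<open>u k\<close> is in the grid and \<open>u (nx k)\<close> is not. Then
  \<open>u (nx k)\<close> is joined to the whole column \<open>k\<close> and to no vertex of column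
  \<open>pv k\<close>, so \<open>u (pv k)\<close> is outside too and is also joined to column
  \<open>k\<close>. Another vertex of that column then has two neighbours in
  \<open>u\<close>.\<close>

lemma tri_in_grid:
  assumes g: "grid g" and u: "tri u" "u k \<in> cells g"
  shows "u l \<in> cells g"
proof -
  have step: "u (nx k) \<in> cells g" if k: "u k \<in> cells g" for k
  proof (rule ccontr)
    assume n: "u (nx k) \<notin> cells g"
    obtain i where i: "u k = g i k" using in_cells[OF g k] triD(2)[OF u(1)] by metis
    have "E (u (nx k)) (g i k)" using triD(4)[OF u(1), of "nx k"] i by simp
    then have aft: "after g (u (nx k))"
      using attach(1)[OF g triD(1)[OF u(1)] n, of "nx k" i] triD(2)[OF u(1)] by simp
    have p: "u (pv k) \<notin> cells g"
    proof
      assume "u (pv k) \<in> cells g"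
      then obtain j where j: "u (pv k) = g j (pv k)"
        using in_cells[OF g] triD(2)[OF u(1)] by metis
      then have "E (u (nx k)) (g j (pv k))" using triD(3)[OF u(1), of "nx k"] by simp
      then show False
        using attach(2)[OF g triD(1)[OF u(1)] n, of "nx k" j] triD(2)[OF u(1)] aft by simp
    qed
    have "E (u (pv k)) (g i k)" using triD(3)[OF u(1), of "pv k"] i by simp
    then have "\<not> after g (u (pv k))"
      using attach(2)[OF g triD(1)[OF u(1)] p, of "pv k" i] triD(2)[OF u(1)] by simp
    then have "E (g (nx i) k) (u (pv k))"
      using attach(4)[OF g triD(1)[OF u(1)] p, of "pv k"] triD(2)[OF u(1)] by simp
    moreover have "E (g (nx i) k) (u (nx k))"
      using attach(3)[OF g triD(1)[OF u(1)] n, of "nx k"] triD(2)[OF u(1)] aft by simp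
    ultimately have "g (nx i) k = u k"
      using no_third[OF u(1)] gridD[OF g] by blast
    then show False using i grid_inject[OF g] by simp
  qed
  show ?thesis using step u(2) colour_cases[of l k] nx_pv(3) by metis
qed

lemma tri_avoid_grid:
  assumes "grid g" "tri u" "u k \<notin> cells g"
  shows "u l \<notin> cells g"
  using tri_in_grid assms by blast

text \<open>The matching between \<open>u\<close> and a diagonal triangle of the grid shifts all
  colours in the same direction.\<close>

lemma after_tri:
  assumes g: "grid g" and u: "tri u" "u k \<notin> cells g"
  shows "after g (u l) \<longleftrightarrow> after g (u k)"
proof -
  have r: "tri (\<lambda>k. g k k)" by (rule grid_tri[OF g]) simp
  have n: "u m \<notin> cells g" for m using tri_avoid_grid[OF g u] .
  then have d: "u m \<noteq> g m m" for m using cellsI by metis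
  have a: "E (u m) (g i (pv m)) \<longleftrightarrow> after g (u m)" "E (u m) (g i (nx m)) \<longleftrightarrow> \<not> after g (u m)" for m i
    using attach[OF g triD(1)[OF u(1)] n] triD(2)[OF u(1)] by auto
  show ?thesis using disjoint_edge_iff(2)[OF u(1) r, of k l] d a by blast
qed

lemma after_edges:
  assumes g: "grid g" and u: "tri u" "u k \<notin> cells g"
  shows "E (u l) (g i (pv l)) \<longleftrightarrow> after g (u k)" "E (u l) (g i (nx l)) \<longleftrightarrow> \<not> after g (u k)"
    and "E (g i (pv l)) (u l) \<longleftrightarrow> after g (u k)" "E (g i (nx l)) (u l) \<longleftrightarrow> \<not> after g (u k)"
  using attach[OF g triD(1)[OF u(1)] tri_avoid_grid[OF g u]] triD(2)[OF u(1)] after_tri[OF g u] by auto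

text \<open>Otherwise \<open>t k\<close> and \<open>u (nx k)\<close> are adjacent and both joined to
  column \<open>pv k\<close>, which gives a triangle leaving the grid.\<close>

lemma after_mono:
  assumes g: "grid g" and t: "tri t" "t k \<notin> cells g" and u: "tri u" "u k \<notin> cells g"
    and a: "arr t u" "after g (t k)"
  shows "after g (u k)"
proof (rule ccontr)
  assume na: "\<not> after g (u k)"
  define w where "w = (\<lambda>l. if l = k then t l else if l = nx k then u l else g k l)"
  have w: "w k = t k" "w (nx k) = u (nx k)" "w (pv k) = g k (pv k)" by (auto simp: w_def)
  have "tri w"
  proof (rule triI[where k = k])
    show "w l \<in> V" "col (w l) = l" for l
      using triD[OF t(1)] triD[OF u(1)] gridD[OF g] by (auto simp: w_def)
    show "E (w k) (w (nx k))" using w arrD(3)[OF a(1)] by simp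
    show "E (w (nx k)) (w (pv k))" using w after_edges(2)[OF g u, of "nx k" k] na by simp
    show "E (w (pv k)) (w k)" using w after_edges(3)[OF g t, of k k] a by simp
  qed
  then show False using tri_in_grid[OF g, of w "pv k" k] w t by simp
qed

end

section \<open>Excluding co-bridges\<close>

text \<open>\<open>p\<close>, \<open>q\<close> and \<open>u\<close>, \<open>v\<close> are the
  opposite pairs of the 4-cycle, \<open>s\<close> and \<open>t\<close> the isolated vertices.
  Distinctness across the pairs follows from the adjacencies.\<close>

locale cobridge_free_prism = coloured_prism +
  assumes no_cobridge: "\<lbrakk>{p, q, u, v, s, t} \<subseteq> V; p \<noteq> q; u \<noteq> v; s \<noteq> t;
     E p u; E p v; E q u; E q v; \<not> E p q; \<not> E u v; \<not> E s t;
     \<not> E s p; \<not> E s q; \<not> E s u; \<not> E s v; \<not> E t p; \<not> E t q; \<not> E t u; \<not> E t v\<rbrakk> \<Longrightarrow> False"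
begin

lemma cobridge_cols:
  assumes "{p, q, u, v, s, t} \<subseteq> V" "p \<noteq> q" "u \<noteq> v" "s \<noteq> t"
    and "col p = col q" "col u = col v" "col s = col t"
    and "E p u" "E p v" "E q u" "E q v"
    and "\<not> E s p" "\<not> E s q" "\<not> E s u" "\<not> E s v" "\<not> E t p" "\<not> E t q" "\<not> E t u" "\<not> E t v"
  shows False
  using no_cobridge[of p q u v s t] same_col assms by simp

text \<open>Along a chain, \<open>x i k\<close> is adjacent to \<open>x j (nx k)\<close> iff i \<le>
  j. This half graph contains a 4-cycle on the first three triangles, and the vertices of colour
  \<open>k\<close> in the last two see none of it.\<close>

lemma chain_le_4:
  assumes xs: "\<forall>t\<in>set xs. tri t" "sorted_wrt arr xs"
  shows "length xs \<le> 4"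
proof (rule ccontr)
  assume "\<not> ?thesis"
  then have len: "4 < length xs" by simp
  define x where "x = (\<lambda>i. xs ! i)"
  have T: "tri (x 0)" "tri (x 1)" "tri (x 2)" "tri (x 3)" "tri (x 4)"
    unfolding x_def by (rule bspec[OF xs(1) nth_mem], use len in linarith)+
  have a: "arr (x i) (x j)" if "i < j" "j \<le> 4" for i j
    using sorted_wrt_nth_less[OF xs(2), of i j] that len by (simp add: x_def)
  have A: "arr (x 0) (x 1)" "arr (x 0) (x 2)" "arr (x 1) (x 2)" "arr (x 1) (x 3)"
    "arr (x 1) (x 4)" "arr (x 2) (x 3)" "arr (x 2) (x 4)" "arr (x 3) (x 4)"
    by (rule a; simp)+
  let ?k = Col0 and ?l = "nx Col0"
  show False
  proof (rule cobridge_cols[of "x 0 ?k" "x 1 ?k" "x 1 ?l" "x 2 ?l" "x 3 ?k" "x 4 ?k"])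
    show "{x 0 ?k, x 1 ?k, x 1 ?l, x 2 ?l, x 3 ?k, x 4 ?k} \<subseteq> V" using T triD(1) by blast
    show "x 0 ?k \<noteq> x 1 ?k" "x 1 ?l \<noteq> x 2 ?l" "x 3 ?k \<noteq> x 4 ?k"
      using A(1,3,8)[THEN arrD(1)] by auto
    show "E (x 0 ?k) (x 1 ?l)" "E (x 0 ?k) (x 2 ?l)" "E (x 1 ?k) (x 1 ?l)" "E (x 1 ?k) (x 2 ?l)"
      using A(1,2,3)[THEN arrD(3)] triD(3)[OF T(2)] by blast+
    show "\<not> E (x 3 ?k) (x 0 ?k)" "\<not> E (x 3 ?k) (x 1 ?k)" "\<not> E (x 4 ?k) (x 0 ?k)" "\<not> E (x 4 ?k) (x 1 ?k)"
      by (rule same_col; use T triD(1,2) in auto)+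
    show "\<not> E (x 3 ?k) (x 1 ?l)" "\<not> E (x 3 ?k) (x 2 ?l)" "\<not> E (x 4 ?k) (x 1 ?l)" "\<not> E (x 4 ?k) (x 2 ?l)"
      using arr_not(3)[OF T(2,4) A(4)] arr_not(3)[OF T(3,4) A(6)] arr_not(3)[OF T(2,5) A(5)]
        arr_not(3)[OF T(3,5) A(7)] by blast+
  qed (use T triD(2) in auto)
qed

lemma no_grid_hits:
  assumes "\<nexists>g. grid g"
  shows "\<exists>X. hits X \<and> card X \<le> 4"
proof -
  obtain X F where XF: "hits X" "packing F" "card X \<le> card F"
    using hitting_eq_packing[OF coloured_prism_axioms assms] by blast
  obtain xs where xs: "set xs = F" "sorted_wrt arr xs" using packing_chain[OF assms XF(2)] by blast
  have "length xs \<le> 4" using chain_le_4 xs XF(2) unfolding packing_def by blast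
  then have "card X \<le> 4" using XF(3) card_length[of xs] unfolding xs(1) by linarith
  then show ?thesis using XF(1) by blast
qed

text \<open>By \<open>after_mono\<close> the attachment of a chain changes at most once, leaving
  four patterns. If it is constant, the 4-cycle lies in the chain and the isolated vertices in the
  grid. Otherwise the triangle attached differently from the other two supplies one vertex of a
  4-cycle whose other vertices are in the grid, and the other two triangles supply the isolated
  vertices.\<close>

lemma grid_chain_le_2:
  assumes g: "grid g"
    and xs: "\<forall>t\<in>set xs. tri t \<and> range t \<subseteq> V - cells g" "sorted_wrt arr xs"
  shows "length xs \<le> 2"
proof (rule ccontr)
  assume "\<not> ?thesis"
  then have len: "2 < length xs" by simp
  define x y z where "x = xs ! 0" and "y = xs ! 1" and "z = xs ! 2"
  have mem: "x \<in> set xs" "y \<in> set xs" "z \<in> set xs"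
    unfolding x_def y_def z_def by (rule nth_mem, use len in linarith)+
  have T: "tri x" "tri y" "tri z" using xs(1) mem by auto
  have N: "x Col0 \<notin> cells g" "y Col0 \<notin> cells g" "z Col0 \<notin> cells g" using xs(1) mem by auto
  have A: "arr x y" "arr x z" "arr y z"
    using sorted_wrt_nth_less[OF xs(2)] len by (auto simp: x_def y_def z_def)
  let ?k = Col0 and ?l = "nx Col0"
  note ax = after_edges[OF g T(1) N(1)] and ay = after_edges[OF g T(2) N(2)]
    and az = after_edges[OF g T(3) N(3)]
  have mono: "after g (x ?k) \<Longrightarrow> after g (y ?k)" "after g (y ?k) \<Longrightarrow> after g (z ?k)"
    using after_mono[OF g T(1) N(1) T(2) N(2) A(1)] after_mono[OF g T(2) N(2) T(3) N(3) A(3)] by auto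
  have V: "x i \<in> V" "y i \<in> V" "z i \<in> V" "g j i \<in> V" for i j
    using T triD(1) gridD(1)[OF g] by auto
  have C: "col (x i) = i" "col (y i) = i" "col (z i) = i" "col (g j i) = i" for i j
    using T triD(2) gridD(2)[OF g] by auto
  have gg: "E (g i k) (g j l) \<longleftrightarrow> i \<noteq> j" if "k \<noteq> l" for i j k l using gridD(3)[OF g that] .
  have E: "E (x ?k) (y ?l)" "E (x ?k) (z ?l)" "E (y ?k) (y ?l)" "E (y ?k) (z ?l)"
    using A[THEN arrD(3)] triD(3)[OF T(2)] by blast+
  have D: "x i \<noteq> y i" "y i \<noteq> z i" for i using A[THEN arrD(1)] by auto
  have GD: "x i \<noteq> g j i" "y i \<noteq> g j i" "z i \<noteq> g j i" for i j
    using tri_avoid_grid[OF g] T N cellsI by metis+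
  have S: "\<not> E p q" if "col p = col q" "p \<in> V" "q \<in> V" for p q using same_col that by blast
  consider "after g (x ?k)" "after g (y ?k)" "after g (z ?k)"
    | "\<not> after g (x ?k)" "\<not> after g (y ?k)" "\<not> after g (z ?k)"
    | "\<not> after g (x ?k)" "after g (y ?k)" "after g (z ?k)"
    | "\<not> after g (x ?k)" "\<not> after g (y ?k)" "after g (z ?k)"
    using mono by blast
  then show False
  proof cases
    case 1
    show False
      by (rule cobridge_cols[of "x ?k" "y ?k" "y ?l" "z ?l" "g Col0 ?l" "g Col1 ?l"])
        (use 1 E D V C S grid_inject[OF g] ax(4)[of _ ?k] ay(4)[of _ ?k] in auto)
  next
    case 2
    show False
      by (rule cobridge_cols[of "x ?k" "y ?k" "y ?l" "z ?l" "g Col0 ?k" "g Col1 ?k"])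
        (use 2 E D V C S grid_inject[OF g] ay(3)[of _ ?l] az(3)[of _ ?l] in auto)
  next
    case 3
    show False
      by (rule cobridge_cols[of "x ?k" "g Col0 ?k" "g Col1 ?l" "g Col2 ?l" "y ?k" "z ?k"])
        (use 3 gg D V C S GD grid_inject[OF g] ax(2)[of ?k] ay(2)[of ?k] az(2)[of ?k] in auto)
  next
    case 4
    show False
      by (rule cobridge_cols[of "z ?l" "g Col0 ?l" "g Col1 ?k" "g Col2 ?k" "x ?l" "y ?l"])
        (use 4 gg D V C S GD grid_inject[OF g] az(1)[of ?l] ax(1)[of ?l] ay(1)[of ?l] in auto)
  qed
qed

text \<open>The cases are the attachments of a further vertex \<open>v\<close> to the two grids.
  Three give a co-bridge; in the third case \<open>v\<close> forms a triangle with one vertex of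
  each grid, against \<open>tri_in_grid\<close>.\<close>

lemma two_grids_cover:
  assumes g: "grid g" and h: "grid h" and gh: "\<And>i j k l. E (g i k) (h j l) \<longleftrightarrow> l = nx k"
  shows "V = cells g \<union> cells h"
proof
  show "cells g \<union> cells h \<subseteq> V" using gridD(1) g h by (auto simp: cells_def)
  show "V \<subseteq> cells g \<union> cells h"
  proof (rule ccontr)
    assume "\<not> ?thesis"
    then obtain v where v: "v \<in> V" "v \<notin> cells g" "v \<notin> cells h" by blast
    obtain k where k: "col v = k" by blast
    note ag = attach[OF g v(1,2) k] and ah = attach[OF h v(1,3) k]
    have gg: "E (g i k) (g j l) \<longleftrightarrow> i \<noteq> j" "E (h i k) (h j l) \<longleftrightarrow> i \<noteq> j" if "k \<noteq> l" for i j k l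
      using gridD(3)[OF g that] gridD(3)[OF h that] by auto
    have V: "g i l \<in> V" "h i l \<in> V" "col (g i l) = l" "col (h i l) = l" for i l
      using gridD g h by auto
    have D: "v \<noteq> g i l" "v \<noteq> h i l" for i l using v cellsI by metis+
    have hg: "E (h j l) (g i k) \<longleftrightarrow> l = nx k" for i j k l using gh E_commute by blast
    note simps = ag ah gg V D gh hg grid_inject[OF g] grid_inject[OF h] k v
    have S: "\<not> E p q" if "col p = col q" "p \<in> V" "q \<in> V" for p q using same_col that by blast
    consider "after g v" "after h v" | "after g v" "\<not> after h v" | "\<not> after g v" "after h v"
      | "\<not> after g v" "\<not> after h v" by blast
    then show False
    proof cases
      case 1
      show False
        by (rule cobridge_cols[of v "h Col0 k" "h Col1 (pv k)" "h Col2 (pv k)" "g Col0 k" "g Col1 k"])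
          (use 1 S in \<open>auto simp: simps\<close>)
    next
      case 2
      show False
        by (rule cobridge_cols[of v "g Col0 k" "g Col1 (pv k)" "g Col2 (pv k)" "h Col0 (pv k)" "h Col1 (pv k)"])
          (use 2 S in \<open>auto simp: simps\<close>)
    next
      case 3
      define w where "w = (\<lambda>l. if l = k then v else if l = nx k then g k l else h k l)"
      have w: "w k = v" "w (nx k) = g k (nx k)" "w (pv k) = h k (pv k)" by (auto simp: w_def)
      have "tri w"
      proof (rule triI[where k = k])
        show "w l \<in> V" "col (w l) = l" for l using V k v by (auto simp: w_def)
      qed (use 3 w in \<open>auto simp: simps\<close>)
      then show False using tri_in_grid[OF g, of w "nx k" k] w v by simp
    next
      case 4
      show False
        by (rule cobridge_cols[of v "g Col0 k" "g Col1 (nx k)" "g Col2 (nx k)" "h Col0 k" "h Col1 k"])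
          (use 4 S in \<open>auto simp: simps\<close>)
    qed
  qed
qed

lemma two_grids_order:
  assumes g: "grid g" and h: "grid h" and d: "cells g \<inter> cells h = {}"
  shows "(\<forall>i j k l. E (g i k) (h j l) \<longleftrightarrow> l = nx k) \<or> (\<forall>i j k l. E (h i k) (g j l) \<longleftrightarrow> l = nx k)"
proof -
  have hn: "h j k \<notin> cells g" "g j k \<notin> cells h" for j k using d cellsI by blast+
  have H: "h j k \<in> V" "col (h j k) = k" "g j k \<in> V" "col (g j k) = k" for j k
    using gridD g h by auto
  have ag: "E (h j k) (g i (pv k)) \<longleftrightarrow> after g (h j k)" "E (h j k) (g i (nx k)) \<longleftrightarrow> \<not> after g (h j k)"
    "E (g i (pv k)) (h j k) \<longleftrightarrow> after g (h j k)" "E (g i (nx k)) (h j k) \<longleftrightarrow> \<not> after g (h j k)"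
    for i j k using attach[OF g H(1) hn(1) H(2)] by blast+
  have ah: "E (g i (pv k)) (h j k) \<longleftrightarrow> \<not> after h (g i (pv k))" for i j k
    using attach(2)[OF h H(3) hn(2) H(4), of i "pv k" j] by simp
  \<comment> \<open>Seen from \<open>h\<close>, a vertex of \<open>g\<close> is joined to a whole
    column of \<open>h\<close> or to none of it, so attachment is constant on columns; the diagonal
    triangle of \<open>h\<close> then links the columns.\<close>
  have same: "after g (h j k) \<longleftrightarrow> after g (h j' k)" for j j' k
    using ag(3)[of Col0 k] ah[of Col0 k] by blast
  have "tri (\<lambda>k. h k k)" by (rule grid_tri[OF h]) simp
  then have "after g (h k k) \<longleftrightarrow> after g (h l l)" for k l
    using after_tri[OF g, of "\<lambda>k. h k k"] hn by blast
  then have const: "after g (h j k) \<longleftrightarrow> after g (h Col0 Col0)" for j k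
    using same by metis
  have nk: "\<not> E (g i k) (h j k)" "\<not> E (h j k) (g i k)" for i j k using same_col H by metis+
  show ?thesis
  proof (cases "after g (h Col0 Col0)")
    case True
    have "E (g i k) (h j l) \<longleftrightarrow> l = nx k" for i j k l
      using colour_cases[of k l] nk ag(3,4)[of i l j] const[of j l] True by auto
    then show ?thesis by blast
  next
    case False
    have "E (h j l) (g i k) \<longleftrightarrow> k = nx l" for i j k l
      using colour_cases[of k l] nk ag(1,2)[of j l i] const[of j l] False by auto
    then show ?thesis by blast
  qed
qed

theorem hits_or_two_grids:
  "(\<exists>X. hits X \<and> card X \<le> 5) \<or>
   (\<exists>g h. grid g \<and> grid h \<and> cells g \<inter> cells h = {} \<and> V = cells g \<union> cells h \<and>
      (\<forall>i j k l. E (g i k) (h j l) \<longleftrightarrow> l = nx k))"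
proof (cases "\<exists>g. grid g")
  case False
  then obtain X where "hits X" "card X \<le> 4" using no_grid_hits by blast
  moreover from this have "card X \<le> 5" by simp
  ultimately show ?thesis by blast
next
  case True
  then obtain g where g: "grid g" by blast
  define W where "W = V - cells g"
  have WV: "W \<subseteq> V" by (auto simp: W_def)
  interpret W: coloured_prism W E col using restrict[OF WV] .
  show ?thesis
  proof (cases "\<exists>h. W.grid h")
    case True
    then obtain h where h: "grid h" "\<And>i. range (h i) \<subseteq> W" using restrict_grid[OF WV] by blast
    have d: "cells g \<inter> cells h = {}" using h(2) by (auto simp: W_def cells_def)
    consider "\<And>i j k l. E (g i k) (h j l) \<longleftrightarrow> l = nx k" | "\<And>i j k l. E (h i k) (g j l) \<longleftrightarrow> l = nx k"
      using two_grids_order[OF g h(1) d] by blast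
    then show ?thesis
    proof cases
      case 1
      then have "V = cells g \<union> cells h" by (rule two_grids_cover[OF g h(1)])
      then show ?thesis using 1 g h(1) d by blast
    next
      case 2
      then have "V = cells h \<union> cells g" by (rule two_grids_cover[OF h(1) g])
      moreover have "cells h \<inter> cells g = {}" using d by blast
      ultimately show ?thesis using 2 g h(1) by blast
    qed
  next
    case False
    obtain X F where XF: "W.hits X" "W.packing F" "card X \<le> card F"
      using hitting_eq_packing[OF W.coloured_prism_axioms False] by blast
    obtain xs where xs: "set xs = F" "sorted_wrt arr xs" using W.packing_chain[OF False XF(2)] by blast
    have "tri t \<and> range t \<subseteq> V - cells g" if "t \<in> set xs" for t
    proof -
      have "W.tri t" using that XF(2) xs(1) unfolding W.packing_def by blast
      then show ?thesis using restrict_tri[OF WV, of t] by (simp add: W_def)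
    qed
    then have "length xs \<le> 2" using grid_chain_le_2[OF g _ xs(2)] by blast
    then have c: "card X \<le> 2" using XF(3) card_length[of xs] unfolding xs(1) by linarith
    \<comment> \<open>One column hits every triangle inside the grid, and all other triangles lie in
      \<open>W\<close>.\<close>
    let ?Y = "range (\<lambda>i. g i Col0)"
    have "card ?Y \<le> 3"
      using card_image_le[of UNIV "\<lambda>i. g i Col0"] by (simp add: UNIV_colour)
    then have "card (X \<union> ?Y) \<le> 5" using c card_Un_le[of X ?Y] by linarith
    moreover have "hits (X \<union> ?Y)"
      unfolding hits_def
    proof (intro conjI allI impI)
      show "X \<union> ?Y \<subseteq> V" using XF(1) WV gridD(1)[OF g] unfolding W.hits_def by blast
      fix t assume t: "tri t"
      show "range t \<inter> (X \<union> ?Y) \<noteq> {}"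
      proof (cases "t Col0 \<in> cells g")
        case True
        then obtain i where "t Col0 = g i Col0" using in_cells[OF g] triD(2)[OF t] by metis
        then show ?thesis by blast
      next
        case False
        then have "range t \<subseteq> W" using tri_avoid_grid[OF g t False] triD(1)[OF t] unfolding W_def by blast
        then show ?thesis using XF(1) t unfolding restrict_hits[OF WV] by blast
      qed
    qed
    ultimately show ?thesis by blast
  qed
qed

end

section \<open>Graphs\<close>

definition num :: "colour \<Rightarrow> nat" where
  "num k = (case k of Col0 \<Rightarrow> 1 | Col1 \<Rightarrow> 2 | Col2 \<Rightarrow> 3)"

lemma num_range: "num k \<in> {1..3}"
  by (cases k; simp add: num_def)

lemma num_inject [simp]: "num k = num l \<longleftrightarrow> k = l"
  by (cases k; cases l; simp add: num_def)

lemma co_schlafli_verts: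
  "RV i j \<in> pverts co_schlafli \<longleftrightarrow> i \<in> {1..3} \<and> j \<in> {1..3}"
  "SV i j \<in> pverts co_schlafli \<longleftrightarrow> i \<in> {1..3} \<and> j \<in> {1..3}"
  by (auto simp: co_schlafli_def Let_def)

lemma co_schlafli_arcs:
  assumes "i \<in> {1..3}" "j \<in> {1..3}" "i' \<in> {1..3}" "j' \<in> {1..3}"
  shows "(RV i j, RV i' j') \<in> parcs co_schlafli \<longleftrightarrow> i \<noteq> i' \<and> j \<noteq> j'"
    and "(SV i j, SV i' j') \<in> parcs co_schlafli \<longleftrightarrow> i \<noteq> i' \<and> j \<noteq> j'"
    and "(RV i j, SV i' j') \<in> parcs co_schlafli \<longleftrightarrow> j = i'"
    and "(SV i' j', RV i j) \<in> parcs co_schlafli \<longleftrightarrow> j = i'"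
  using assms by (auto simp: co_schlafli_def Let_def)

text \<open>The witness is the image of \<open>F\<close> under \<open>f\<close>. As \<open>f\<close>
  preserves adjacency both ways, its arcs are all the arcs of \<open>G\<close> between image
  vertices.\<close>

lemma isomorphic_to_inducedI:
  fixes F :: "'b pair_pre_digraph" and G :: "'a pair_pre_digraph"
  assumes G: "pair_wf_digraph G" and F: "pair_wf_digraph F"
    and f: "inj_on f (pverts F)" "f ` pverts F \<subseteq> pverts G"
    and arcs: "\<And>x y. x \<in> pverts F \<Longrightarrow> y \<in> pverts F \<Longrightarrow> (x, y) \<in> parcs F \<longleftrightarrow> (f x, f y) \<in> parcs G"
  shows "isomorphic_to_induced_subgraph F G"
proof -
  interpret F: pair_wf_digraph F by fact
  let ?H = "\<lparr>pverts = f ` pverts F, parcs = map_prod f f ` parcs F\<rparr>"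
  let ?h = "\<lparr>iso_verts = f, iso_arcs = map_prod f f, iso_head = snd, iso_tail = fst\<rparr>"
  have wfH: "pair_wf_digraph ?H"
  proof
    fix e assume "e \<in> parcs ?H"
    then obtain a b where "(a, b) \<in> parcs F" "e = (f a, f b)" by auto
    then show "fst e \<in> pverts ?H" "snd e \<in> pverts ?H" using F.in_arcsD1 F.in_arcsD2 by auto
  qed
  have "inj_on (map_prod f f) (pverts F \<times> pverts F)"
    by (rule map_prod_inj_on[OF f(1) f(1)])
  then have inj: "inj_on (map_prod f f) (parcs F)"
    by (rule inj_on_subset) (auto simp: F.in_arcsD1 F.in_arcsD2)
  have "pre_digraph.digraph_isomorphism (with_proj F) ?h"
    unfolding pre_digraph.digraph_isomorphism_def
  proof (intro conjI)
    show "inj_on (iso_verts ?h) (verts (with_proj F))"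
      unfolding digraph_isomorphism.simps with_proj_simps by (rule f(1))
    show "inj_on (iso_arcs ?h) (arcs (with_proj F))" using inj by simp
  qed (simp_all add: wf_digraph_wp_iff F)
  moreover have "with_proj ?H = app_iso ?h (with_proj F)"
    by (simp add: app_iso_def with_proj_def)
  ultimately have iso: "digraph_iso (with_proj F) (with_proj ?H)"
    unfolding digraph_iso_def by blast
  have arcsH: "parcs ?H = {e \<in> parcs G. fst e \<in> pverts ?H \<and> snd e \<in> pverts ?H}"
  proof (intro equalityI subsetI)
    fix e assume "e \<in> parcs ?H"
    then obtain a b where e: "(a, b) \<in> parcs F" "e = (f a, f b)" by auto
    then have "a \<in> pverts F" "b \<in> pverts F" using F.in_arcsD1 F.in_arcsD2 by blast+
    then show "e \<in> {e \<in> parcs G. fst e \<in> pverts ?H \<and> snd e \<in> pverts ?H}"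
      using e arcs[of a b] by simp
  next
    fix e assume "e \<in> {e \<in> parcs G. fst e \<in> pverts ?H \<and> snd e \<in> pverts ?H}"
    then obtain a b where "a \<in> pverts F" "b \<in> pverts F" "e = (f a, f b)" "e \<in> parcs G"
      by (cases e) auto
    moreover from this have "(a, b) \<in> parcs F" using arcs[of a b] by simp
    ultimately show "e \<in> parcs ?H" by (auto intro: image_eqI[of _ _ "(a, b)"])
  qed
  have "induced_subgraph (with_proj ?H) (with_proj G)"
    unfolding induced_subgraph_def subgraph_def
  proof (intro conjI)
    show "verts (with_proj ?H) \<subseteq> verts (with_proj G)" using f(2) by simp
    show "wf_digraph (with_proj G)" "wf_digraph (with_proj ?H)"
      using G wfH by (simp_all add: wf_digraph_wp_iff)
    show "compatible (with_proj G) (with_proj ?H)" by (simp add: compatible_def)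
    show "arcs (with_proj ?H) = {e \<in> arcs (with_proj G). tail (with_proj G) e \<in> verts (with_proj ?H) \<and>
        head (with_proj G) e \<in> verts (with_proj ?H)}"
      unfolding with_proj_simps by (rule arcsH)
    show "arcs (with_proj ?H) \<subseteq> arcs (with_proj G)"
      unfolding with_proj_simps arcsH by blast
  qed
  with iso show ?thesis unfolding isomorphic_to_induced_subgraph_def by blast
qed

lemma pair_wf_co_bridge: "pair_wf_digraph co_bridge"
  by unfold_locales (auto simp: co_bridge_def Let_def)

lemma pair_wf_co_schlafli: "pair_wf_digraph co_schlafli"
  by unfold_locales (auto simp: co_schlafli_def Let_def)

lemma co_bridge_freeD:
  assumes G: "pair_graph G" and free: "co_bridge_free G"
    and V: "{p, q, u, v, s, t} \<subseteq> pverts G" and d: "p \<noteq> q" "u \<noteq> v" "s \<noteq> t"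
    and e: "(p, u) \<in> parcs G" "(p, v) \<in> parcs G" "(q, u) \<in> parcs G" "(q, v) \<in> parcs G"
    and n: "(p, q) \<notin> parcs G" "(u, v) \<notin> parcs G" "(s, t) \<notin> parcs G"
      "(s, p) \<notin> parcs G" "(s, q) \<notin> parcs G" "(s, u) \<notin> parcs G" "(s, v) \<notin> parcs G"
      "(t, p) \<notin> parcs G" "(t, q) \<notin> parcs G" "(t, u) \<notin> parcs G" "(t, v) \<notin> parcs G"
  shows False
proof -
  interpret pair_graph G by fact
  \<comment> \<open>The list follows the 4-cycle \<open>p\<close>, \<open>u\<close>,
    \<open>q\<close>, \<open>v\<close> in order, matching vertices 0 to 3; the isolated vertices
    come last.\<close>
  define f where "f = (\<lambda>n :: nat. [p, u, q, v, s, t] ! n)"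
  have f: "f 0 = p" "f 1 = u" "f (Suc 0) = u" "f 2 = q" "f 3 = v" "f 4 = s" "f 5 = t"
    by (simp_all add: f_def eval_nat_numeral)
  have pv: "pverts co_bridge = {0, 1, 2, 3, 4, 5}" by (simp add: co_bridge_def)
  have loop: "(x, x) \<notin> parcs G" for x using no_loops' by blast
  have e': "(u, p) \<in> parcs G" "(v, p) \<in> parcs G" "(u, q) \<in> parcs G" "(v, q) \<in> parcs G"
    using e arcs_symmetric by blast+
  have n': "(q, p) \<notin> parcs G" "(v, u) \<notin> parcs G" "(t, s) \<notin> parcs G"
      "(p, s) \<notin> parcs G" "(q, s) \<notin> parcs G" "(u, s) \<notin> parcs G" "(v, s) \<notin> parcs G"
      "(p, t) \<notin> parcs G" "(q, t) \<notin> parcs G" "(u, t) \<notin> parcs G" "(v, t) \<notin> parcs G"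
    using n arcs_symmetric by blast+
  have d': "distinct [p, u, q, v, s, t]"
    using d e n n' loop by auto
  have "isomorphic_to_induced_subgraph co_bridge G"
  proof (rule isomorphic_to_inducedI[where f = f])
    show "pair_wf_digraph G" by unfold_locales
    show "pair_wf_digraph co_bridge" by (rule pair_wf_co_bridge)
    show "inj_on f (pverts co_bridge)" using d' by (auto simp: pv f inj_on_def)
    show "f ` pverts co_bridge \<subseteq> pverts G" using V by (auto simp: pv f)
    fix x y assume "x \<in> pverts co_bridge" "y \<in> pverts co_bridge"
    then show "(x, y) \<in> parcs co_bridge \<longleftrightarrow> (f x, f y) \<in> parcs G"
      unfolding pv using e e' n n' loop by (elim insertE emptyE) (simp_all add: f co_bridge_def)
  qed
  then show False using free unfolding co_bridge_free_def by blast
qed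

lemma coloured_prism_of_graph:
  assumes G: "pair_graph G" and col: "three_colorable G" and free: "co_bridge_free G" and "prismatic G"
  shows "\<exists>col. cobridge_free_prism (pverts G) (\<lambda>x y. (x, y) \<in> parcs G) col"
proof -
  interpret pair_graph G by fact
  obtain A B C where S: "stable_set G A" "stable_set G B" "stable_set G C"
    and U: "A \<union> B \<union> C = pverts G" using col unfolding three_colorable_def by blast
  define col where "col = (\<lambda>x. if x \<in> A then Col0 else if x \<in> B then Col1 else Col2)"
  have "cobridge_free_prism (pverts G) (\<lambda>x y. (x, y) \<in> parcs G) col"
  proof
    show "finite (pverts G)" by simp
    show "(y, x) \<in> parcs G" if "(x, y) \<in> parcs G" for x y using that arcs_symmetric by blast
    show proper: "col x \<noteq> col y" if "x \<in> pverts G" "y \<in> pverts G" "(x, y) \<in> parcs G" for x y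
    proof -
      have "x \<in> A \<or> x \<in> B \<or> x \<in> C" "y \<in> A \<or> y \<in> B \<or> y \<in> C" using that U by auto
      then show ?thesis
        using that(3) S unfolding col_def stable_set_def by (auto split: if_splits)
    qed
    fix t v
    assume t: "\<And>k. t k \<in> pverts G \<and> col (t k) = k \<and> (t k, t (nx k)) \<in> parcs G"
      and v: "v \<in> pverts G" "v \<noteq> t (col v)"
    have inj: "inj t" by (rule injI) (metis t)
    have e: "(t k, t l) \<in> parcs G" if "k \<noteq> l" for k l
      using t[of k] t[of l] that colour_cases[of l k] arcs_symmetric by (metis nx_pv(1))
    have "triangle G (range t)"
      unfolding triangle_def using t e card_image[OF inj] by (auto simp: UNIV_colour)
    moreover have "v \<notin> range t" using v(2) t by (metis imageE)
    ultimately have "\<exists>!u. u \<in> range t \<and> (v, u) \<in> parcs G"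
      using \<open>prismatic G\<close> v(1) unfolding prismatic_def by blast
    then obtain k where k: "(v, t k) \<in> parcs G" "\<And>l. (v, t l) \<in> parcs G \<Longrightarrow> t l = t k" by blast
    have "k \<noteq> col v" using proper[OF v(1) _ k(1)] t by metis
    moreover have "(v, t l) \<in> parcs G \<longleftrightarrow> l = k" for l
      using k inj by (auto dest: injD)
    ultimately show "(v, t (nx (col v))) \<in> parcs G \<longleftrightarrow> (v, t (pv (col v))) \<notin> parcs G"
      using colour_cases[of k "col v"] by auto
  next
    fix p q u v s t
    assume "{p, q, u, v, s, t} \<subseteq> pverts G" "p \<noteq> q" "u \<noteq> v" "s \<noteq> t"
     "(p, u) \<in> parcs G" "(p, v) \<in> parcs G" "(q, u) \<in> parcs G" "(q, v) \<in> parcs G"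
     "(p, q) \<notin> parcs G" "(u, v) \<notin> parcs G" "(s, t) \<notin> parcs G"
     "(s, p) \<notin> parcs G" "(s, q) \<notin> parcs G" "(s, u) \<notin> parcs G" "(s, v) \<notin> parcs G"
     "(t, p) \<notin> parcs G" "(t, q) \<notin> parcs G" "(t, u) \<notin> parcs G" "(t, v) \<notin> parcs G"
    then show False by (rule co_bridge_freeD[OF G free])
  qed
  then show ?thesis by blast
qed

lemma hitting_number_le_of_hits:
  assumes P: "coloured_prism (pverts G) (\<lambda>x y. (x, y) \<in> parcs G) col"
    and X: "coloured_prism.hits (pverts G) (\<lambda>x y. (x, y) \<in> parcs G) col X"
  shows "hitting_number G \<le> card X"
proof -
  interpret coloured_prism "pverts G" "\<lambda>x y. (x, y) \<in> parcs G" col by fact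
  have "X \<inter> T \<noteq> {}" if T: "triangle G T" for T
  proof -
    have T': "T \<subseteq> pverts G" "card T = 3" "\<And>u v. u \<in> T \<Longrightarrow> v \<in> T \<Longrightarrow> u \<noteq> v \<Longrightarrow> (u, v) \<in> parcs G"
      using T unfolding triangle_def by auto
    have inj: "inj_on col T"
      using T' same_col by (meson inj_onI subsetD)
    have "card (col ` T) = card (UNIV :: colour set)"
      using card_image[OF inj] T'(2) by (simp add: UNIV_colour)
    then have im: "col ` T = UNIV" by (intro card_subset_eq) auto
    \<comment> \<open>A triangle of the graph has exactly one vertex of each colour, so inverting
      \<open>col\<close> on it gives its colour-indexed form.\<close>
    define t where "t = inv_into T col"
    have t: "t k \<in> T" "col (t k) = k" for k
      unfolding t_def using im inv_into_into[of k col T] f_inv_into_f[of k col T] by auto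
    have "t k \<noteq> t (nx k)" for k using t(2) by (metis nx_neq(2))
    then have "tri t" unfolding tri_def using t T' by blast
    then show ?thesis using X t(1) unfolding hits_def by blast
  qed
  then have "hitting_set G X" using X unfolding hits_def hitting_set_def by blast
  then show ?thesis unfolding hitting_number_def by (intro Least_le) blast
qed

text \<open>
  In the notation of the co-Schlaefli graph, colour classes of the first grid are columns of \<open>r\<close> and
  colour classes of the second grid are rows of \<open>s\<close>, shifted by one.
\<close>

lemma two_grids_schlafli:
  assumes G: "pair_graph G" and P: "coloured_prism (pverts G) (\<lambda>x y. (x, y) \<in> parcs G) col"
    and g: "coloured_prism.grid (pverts G) (\<lambda>x y. (x, y) \<in> parcs G) col g"
    and h: "coloured_prism.grid (pverts G) (\<lambda>x y. (x, y) \<in> parcs G) col h"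
    and V: "pverts G = coloured_prism.cells g \<union> coloured_prism.cells h"
    and d: "coloured_prism.cells g \<inter> coloured_prism.cells h = {}"
    and gh: "\<And>i j k l. (g i k, h j l) \<in> parcs G \<longleftrightarrow> l = nx k"
  shows "schlafli_prismatic G"
proof -
  interpret pair_graph G by fact
  interpret P: coloured_prism "pverts G" "\<lambda>x y. (x, y) \<in> parcs G" col by fact
  define row where "row = (\<lambda>g :: colour \<Rightarrow> colour \<Rightarrow> 'a. \<lambda>v. THE i. v = g i (col v))"
  define f where "f = (\<lambda>v. if v \<in> P.cells g then RV (num (row g v)) (num (col v))
    else SV (num (pv (col v))) (num (row h v)))"
  have row: "row g (g i k) = i" "row h (h i k) = i" for i k
    unfolding row_def using P.grid_inject[OF g] P.grid_inject[OF h] P.gridD(2)[OF g] P.gridD(2)[OF h]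
    by (auto intro!: the_equality)
  have hg: "h i k \<notin> P.cells g" for i k using d P.cellsI by blast
  have f: "f (g i k) = RV (num i) (num k)" "f (h i k) = SV (num (pv k)) (num i)" for i k
    using hg P.gridD(2)[OF g] P.gridD(2)[OF h] row by (simp_all add: f_def)
  have cell: "(\<exists>i k. v = g i k) \<or> (\<exists>i k. v = h i k)" if "v \<in> pverts G" for v
    using that unfolding V P.cells_def by blast
  have gg: "(g i k, g j l) \<in> parcs G \<longleftrightarrow> i \<noteq> j \<and> k \<noteq> l" "(h i k, h j l) \<in> parcs G \<longleftrightarrow> i \<noteq> j \<and> k \<noteq> l" for i j k l
    using P.gridD[OF g] P.gridD[OF h] P.same_col by (metis (no_types, lifting))+
  have hg': "(h j l, g i k) \<in> parcs G \<longleftrightarrow> l = nx k" for i j k l using gh arcs_symmetric by blast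
  \<comment> \<open>This turns the r-s adjacency rule, which reads \<open>k = pv l\<close> under
    \<open>f\<close>, into the rule \<open>l = nx k\<close> between the grids.\<close>
  have sh: "k = pv l \<longleftrightarrow> l = nx k" for k l by (metis nx_pv(1,2))
  have "isomorphic_to_induced_subgraph G co_schlafli"
  proof (rule isomorphic_to_inducedI[where f = f])
    show "pair_wf_digraph G" by unfold_locales
    show "pair_wf_digraph co_schlafli" by (rule pair_wf_co_schlafli)
    show "inj_on f (pverts G)"
    proof (rule inj_onI)
      fix x y assume "x \<in> pverts G" "y \<in> pverts G" "f x = f y"
      then show "x = y" using cell[of x] cell[of y] by (auto simp: f)
    qed
    show "f ` pverts G \<subseteq> pverts co_schlafli"
      using cell num_range by (fastforce simp: f co_schlafli_verts)
    fix x y assume "x \<in> pverts G" "y \<in> pverts G"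
    from cell[OF this(1)] cell[OF this(2)]
    show "(x, y) \<in> parcs G \<longleftrightarrow> (f x, f y) \<in> parcs co_schlafli"
      by (elim disjE exE) (auto simp: f gg gh hg' sh co_schlafli_arcs[OF num_range num_range num_range num_range])
  qed
  then show ?thesis unfolding schlafli_prismatic_def .
qed

theorem theorem4p1:
  fixes G :: "'a pair_pre_digraph"
  assumes "pair_graph G"
    and "three_colorable G"
    and "co_bridge_free G"
    and "prismatic G"
  shows "hitting_number G \<le> 5 \<or> schlafli_prismatic G"
proof -
  obtain col where "cobridge_free_prism (pverts G) (\<lambda>x y. (x, y) \<in> parcs G) col"
    using coloured_prism_of_graph[OF assms] by blast
  then interpret cobridge_free_prism "pverts G" "\<lambda>x y. (x, y) \<in> parcs G" col .
  note P = coloured_prism_axioms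
  show ?thesis
    using hits_or_two_grids
  proof (elim disjE exE conjE)
    fix X assume "hits X" "card X \<le> 5"
    then show ?thesis using hitting_number_le_of_hits[OF P] by fastforce
  next
    fix g h assume "grid g" "grid h" "cells g \<inter> cells h = {}" "pverts G = cells g \<union> cells h"
      "\<forall>i j k l. (g i k, h j l) \<in> parcs G \<longleftrightarrow> l = nx k"
    then show ?thesis using two_grids_schlafli[OF assms(1) P] by blast
  qed
qed

end
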